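(* Let $T>0$ and $L\ge 0$ be constants, and let $l_1,l_2:[0,T]\to\mathbb{R}$ be continuously differentiable functions with $l_1(0)=0$, $l_2(0)=L$ and $l_1(s)<l_2(s)$ for all $s>0$. Let $q_0\in \mathbf{C}^1[0,L]$ and $f_0,g_0\in \mathbf{C}^1[0,T]$. Let $q(x,t)$ be the solution of the linear Schrödinger equation $iq_t+q_{xx}=0$ in the domain $\{(x,t): l_1(t)<x<l_2(t),\ 0<t<T\}$ satisfying the initial and Dirichlet boundary conditions $$q(x,0)=q_0(x),\ 0<x<L;\qquad q(l_1(t),t)=f_0(t),\quad q(l_2(t),t)=g_0(t),\ 0<t<T.$$ Denote the Neumann boundary values by $$f_1(t)=q_x(l_1(t),t),\qquad g_1(t)=q_x(l_2(t),t),\qquad 0<t<T.$$ Then $f_1$ and $g_1$ can be expressed in terms of the given initial and boundary data as the solution of the following system of coupled linear integral equations, i.e. they satisfy $$\pi f_1(t)=N_1(t)+\int_{0}^{t}K_{11}(t,s)f_1(s)\,ds-\lim_{\varepsilon\to 0}\int_0^tK_{12}(t,s,\varepsilon)g_1(s)\,ds,\qquad 0<t<T,$$ $$\pi g_1(t)=N_2(t)+\lim_{\varepsilon\to 0}\int_{0}^{t}K_{21}(t,s,\varepsilon)f_1(s)\,ds-\int_0^tK_{22}(t,s)g_1(s)\,ds,\qquad 0<t<T,$$ where, for $j=1,2$, $$N_j(t)=\frac{(1-i)\sqrt{2\pi}}{2}\left\{\frac{1}{\sqrt{t}}\int_{0}^{L}e^{\frac{i(x-l_j(t))^2}{4t}}q'_0(x)\,dx-\int_{0}^{t}\left[\frac{e^{\frac{i(l_j(t)-l_1(s))^2}{4(t-s)}}}{\sqrt{t-s}}f_0'(s)-\frac{e^{\frac{i(l_j(t)-l_2(s))^2}{4(t-s)}}}{\sqrt{t-s}}g_0'(s)\right]ds\right\},$$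 $$K_{jj}(t,s)=\frac{(1-i)\sqrt{2\pi}}{4}\,\frac{l_j(t)-l_j(s)}{t-s}\,\frac{e^{\frac{i(l_j(t)-l_j(s))^2}{4(t-s)}}}{\sqrt{t-s}},\qquad 0<s<t<T,$$ and, for $j,m\in\{1,2\}$ with $j\ne m$ and $\varepsilon>0$, $$K_{jm}(t,s,\varepsilon)=\frac{(1-i)\sqrt{2\pi}}{4}\,\frac{l_j(t)-l_m(s)}{t-s-i\varepsilon}\,\frac{e^{\frac{i(l_j(t)-l_m(s))^2}{4(t-s-i\varepsilon)}}}{\sqrt{t-s-i\varepsilon}},\qquad 0<s<t<T.$$
   Context: Functions are complex-valued and a prime denotes the ordinary derivative. The square root of $t-s-i\varepsilon$ is the principal branch, and limits $\varepsilon\to0$ are taken through $\varepsilon>0$. The solution $q$ is understood to be sufficiently regular up to the boundary of the domain for the Neumann boundary values to be well defined, with $f_1,g_1\in \mathbf{C}[0,T]$. *)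

theory Defs
  imports "HOL-Analysis.Analysis"
begin

text \<open>The derivative is one-sided at the end points of an interval, so nothing is assumed about
  \<open>f\<close> outside \<open>S\<close> (the library's \<open>C1_differentiable_on\<close> uses two-sided derivatives).\<close>

definition C1_on :: "real set \<Rightarrow> (real \<Rightarrow> 'a::real_normed_vector) \<Rightarrow> bool" where
  "C1_on S f \<longleftrightarrow>
     (\<exists>f'. (\<forall>s\<in>S. (f has_vector_derivative f' s) (at s within S)) \<and> continuous_on S f')"

definition open_dom :: "real \<Rightarrow> (real \<Rightarrow> real) \<Rightarrow> (real \<Rightarrow> real) \<Rightarrow> (real \<times> real) set" where
  "open_dom T l1 l2 = {(x, t). 0 < t \<and> t < T \<and> l1 t < x \<and> x < l2 t}"

text \<open>\<open>lateral_dom\<close> adds to the open domain the two moving boundaries for \<open>0 < t < T\<close>;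
  \<open>initial_dom\<close> adds in addition the initial segment together with its corners.\<close>

definition lateral_dom :: "real \<Rightarrow> (real \<Rightarrow> real) \<Rightarrow> (real \<Rightarrow> real) \<Rightarrow> (real \<times> real) set" where
  "lateral_dom T l1 l2 = {(x, t). 0 < t \<and> t < T \<and> l1 t \<le> x \<and> x \<le> l2 t}"

definition initial_dom :: "real \<Rightarrow> (real \<Rightarrow> real) \<Rightarrow> (real \<Rightarrow> real) \<Rightarrow> (real \<times> real) set" where
  "initial_dom T l1 l2 = {(x, t). 0 \<le> t \<and> t < T \<and> l1 t \<le> x \<and> x \<le> l2 t}"

text \<open>\<open>q\<close> is a classical solution of \<open>i q\<^sub>t + q\<^sub>x\<^sub>x = 0\<close> in the open domain, with \<open>x\<close>-derivative \<open>qx\<close>.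
  On the moving boundaries \<open>qx\<close> is the one-sided derivative and it is continuous up to them for
  \<open>0 < t < T\<close>; \<open>q\<close> itself is continuous up to the moving boundaries and up to the initial segment
  including its corners, which forces compatibility of initial and Dirichlet data there.\<close>

definition schrodinger_solution ::
  "real \<Rightarrow> (real \<Rightarrow> real) \<Rightarrow> (real \<Rightarrow> real) \<Rightarrow> (real \<Rightarrow> real \<Rightarrow> complex) \<Rightarrow> (real \<Rightarrow> real \<Rightarrow> complex) \<Rightarrow> bool"
  where
  "schrodinger_solution T l1 l2 q qx \<longleftrightarrow>
     (\<exists>qt qxx.
        (\<forall>(x, t) \<in> open_dom T l1 l2.
           ((\<lambda>s. q x s) has_vector_derivative qt x t) (at t) \<and>
           ((\<lambda>y. qx y t) has_vector_derivative qxx x t) (at x) \<and>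
           \<i> * qt x t + qxx x t = 0) \<and>
        continuous_on (open_dom T l1 l2) (\<lambda>(x, t). qt x t) \<and>
        continuous_on (open_dom T l1 l2) (\<lambda>(x, t). qxx x t)) \<and>
     (\<forall>(x, t) \<in> lateral_dom T l1 l2.
        ((\<lambda>y. q y t) has_vector_derivative qx x t) (at x within {l1 t..l2 t})) \<and>
     continuous_on (lateral_dom T l1 l2) (\<lambda>(x, t). qx x t) \<and>
     continuous_on (initial_dom T l1 l2) (\<lambda>(x, t). q x t)"

text \<open>In the following, \<open>lj\<close> and \<open>lm\<close> stand for one of \<open>l1\<close>, \<open>l2\<close>.\<close>

definition K_diag :: "(real \<Rightarrow> real) \<Rightarrow> real \<Rightarrow> real \<Rightarrow> complex" where
  "K_diag lj t s =
     (1 - \<i>) * of_real (sqrt (2 * pi)) / 4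
     * of_real ((lj t - lj s) / (t - s))
     * (exp (\<i> * of_real ((lj t - lj s)\<^sup>2 / (4 * (t - s)))) / of_real (sqrt (t - s)))"

definition K_off :: "(real \<Rightarrow> real) \<Rightarrow> (real \<Rightarrow> real) \<Rightarrow> real \<Rightarrow> real \<Rightarrow> real \<Rightarrow> complex" where
  "K_off lj lm t s \<epsilon> =
     (let z = of_real (t - s) - \<i> * of_real \<epsilon> in
      (1 - \<i>) * of_real (sqrt (2 * pi)) / 4
      * (of_real (lj t - lm s) / z)
      * (exp (\<i> * of_real ((lj t - lm s)\<^sup>2) / (4 * z)) / csqrt z))"

definition dirichlet_integrand ::
  "real \<Rightarrow> (real \<Rightarrow> real) \<Rightarrow> (real \<Rightarrow> real) \<Rightarrow> (real \<Rightarrow> complex) \<Rightarrow> (real \<Rightarrow> complex)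
   \<Rightarrow> (real \<Rightarrow> real) \<Rightarrow> real \<Rightarrow> real \<Rightarrow> complex" where
  "dirichlet_integrand T l1 l2 f0 g0 lj t s =
     exp (\<i> * of_real ((lj t - l1 s)\<^sup>2 / (4 * (t - s)))) / of_real (sqrt (t - s))
       * vector_derivative f0 (at s within {0..T})
     - exp (\<i> * of_real ((lj t - l2 s)\<^sup>2 / (4 * (t - s)))) / of_real (sqrt (t - s))
       * vector_derivative g0 (at s within {0..T})"

definition N_data ::
  "real \<Rightarrow> real \<Rightarrow> (real \<Rightarrow> real) \<Rightarrow> (real \<Rightarrow> real) \<Rightarrow> (real \<Rightarrow> complex) \<Rightarrow> (real \<Rightarrow> complex) \<Rightarrow> (real \<Rightarrow> complex)
   \<Rightarrow> (real \<Rightarrow> real) \<Rightarrow> real \<Rightarrow> complex" where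
  "N_data T L l1 l2 q0 f0 g0 lj t =
     (1 - \<i>) * of_real (sqrt (2 * pi)) / 2 *
     (1 / of_real (sqrt t)
        * integral {0..L} (\<lambda>x. exp (\<i> * of_real ((x - lj t)\<^sup>2 / (4 * t)))
                                * vector_derivative q0 (at x within {0..L}))
      - integral {0..t} (dirichlet_integrand T l1 l2 f0 g0 lj t))"

end

theory Submission
  imports Defs "HOL-Probability.Distributions"
begin

text \<open>With \<open>z = t - s - i \<epsilon>\<close> the kernel \<open>G(x, s) = exp (i (x - x\<^sub>0)\<^sup>2 / (4 z)) / \<surd>z\<close> is, for \<open>\<epsilon> > 0\<close>, a
  smooth solution of the adjoint equation \<open>G\<^sub>s = - i G\<^sub>x\<^sub>x\<close> up to and including \<open>s = t\<close>. Green's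
  formula for \<open>q\<close> and \<open>G\<^sub>x\<close> on \<open>0 \<le> s \<le> t\<close>, followed by an integration by parts along each side of
  the domain, relates the integral of \<open>G q\<^sub>x\<close> at time \<open>t\<close> to the derivatives of the data and to the
  Neumann values; no mixed or third derivative of \<open>q\<close> is needed. Now take \<open>x\<^sub>0 = l\<^sub>j t\<close> and let
  \<open>\<epsilon> \<rightarrow> 0\<close>. At \<open>s = t\<close> the kernel is a Gaussian centred at an end point of the interval, so it
  reproduces half of the boundary value of \<open>q\<^sub>x\<close>; the terms with the data and the diagonal kernel are
  dominated by a multiple of \<open>1 / \<surd>(t - s)\<close>. All terms but the off-diagonal one converge, hence so
  does the off-diagonal one.\<close>

section \<open>The regularised kernel\<close>

text \<open>Up to a constant factor, the fundamental solution of the free Schroedinger equation at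
  complex time \<open>z\<close>. Both arguments are complex, so that complex differentiation
  applies; the real derivatives in \<open>x\<close> and \<open>s\<close> follow by the chain
  rule.\<close>

definition skernel :: "complex \<Rightarrow> complex \<Rightarrow> complex" where
  "skernel z y = exp (\<i> * y\<^sup>2 / (4 * z)) / csqrt z"

definition skernel_y :: "complex \<Rightarrow> complex \<Rightarrow> complex" where
  "skernel_y z y = \<i> * y / (2 * z) * skernel z y"

definition skernel_yy :: "complex \<Rightarrow> complex \<Rightarrow> complex" where
  "skernel_yy z y = (\<i> / (2 * z) - y\<^sup>2 / (4 * z\<^sup>2)) * skernel z y"

definition skernel_yyy :: "complex \<Rightarrow> complex \<Rightarrow> complex" where
  "skernel_yyy z y = (- (3 * y) / (4 * z\<^sup>2) - \<i> * y ^ 3 / (8 * z ^ 3)) * skernel z y"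

lemma skernel_deriv_y:
  assumes "z \<noteq> 0"
  shows "(skernel z has_field_derivative skernel_y z y) (at y)"
    "(skernel_y z has_field_derivative skernel_yy z y) (at y)"
    "(skernel_yy z has_field_derivative skernel_yyy z y) (at y)"
proof -
  show *: "(skernel z has_field_derivative skernel_y z y) (at y)"
    unfolding skernel_def [abs_def] skernel_y_def using assms
    by (auto intro!: derivative_eq_intros simp: field_simps)
  show **: "(skernel_y z has_field_derivative skernel_yy z y) (at y)"
    unfolding skernel_y_def [abs_def] skernel_yy_def using assms
    by (auto intro!: derivative_eq_intros * simp: skernel_y_def field_simps power2_eq_square)
  show "(skernel_yy z has_field_derivative skernel_yyy z y) (at y)"
    unfolding skernel_yy_def [abs_def] skernel_yyy_def using assms
    by (auto intro!: derivative_eq_intros * simp: skernel_y_def field_simps power2_eq_square power3_eq_cube)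
qed

text \<open>In \<open>z\<close> the kernel solves the same equation as \<open>q\<close> does in
  \<open>t\<close>; since \<open>z\<close> contains \<open>- s\<close>, this becomes the adjoint
  equation in \<open>s\<close>. The assumption keeps \<open>z\<close> off the branch cut of
  \<open>csqrt\<close>. The second fact is the first one differentiated in \<open>y\<close>.\<close>

lemma skernel_deriv_z:
  assumes "z \<notin> \<real>\<^sub>\<le>\<^sub>0"
  shows "((\<lambda>z. skernel z y) has_field_derivative \<i> * skernel_yy z y) (at z)"
    "((\<lambda>z. skernel_y z y) has_field_derivative \<i> * skernel_yyy z y) (at z)"
proof -
  have [simp]: "z \<noteq> 0" "csqrt z \<noteq> 0" using assms by auto
  have s: "csqrt z * csqrt z = z" by (metis power2_csqrt power2_eq_square)
  have s': "csqrt z * (csqrt z * u) = z * u" for u by (metis s mult.assoc)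
  show *: "((\<lambda>z. skernel z y) has_field_derivative \<i> * skernel_yy z y) (at z)"
    unfolding skernel_def skernel_yy_def using assms
    apply (auto intro!: derivative_eq_intros simp: s)
    apply (auto simp add: field_simps power2_eq_square s s')
    done
  show "((\<lambda>z. skernel_y z y) has_field_derivative \<i> * skernel_yyy z y) (at z)"
    unfolding skernel_y_def skernel_yyy_def using assms
    apply (auto intro!: derivative_eq_intros *)
    apply (auto simp add: skernel_yy_def field_simps power2_eq_square power3_eq_cube)
    done
qed

section \<open>Green's formula on a moving domain\<close>

lemma continuous_on_Pair_compose:
  assumes "continuous_on S (\<lambda>(x, y). f x y)" "continuous_on A g" "continuous_on A h"
    and "\<And>a. a \<in> A \<Longrightarrow> (g a, h a) \<in> S"
  shows "continuous_on A (\<lambda>a. f (g a) (h a))"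
  using continuous_on_compose2[OF assms(1) continuous_on_Pair[OF assms(2,3)]] assms(4) by auto

text \<open>One partial derivative at the point and the other one continuous nearby give total
  differentiability, and then the chain rule applies. The set \<open>S\<close> covers one-sided
  derivatives at the ends of a time interval.\<close>

lemma has_vector_derivative_along_curve:
  fixes f fx ft :: "real \<Rightarrow> real \<Rightarrow> 'a::real_normed_vector"
  assumes "open D" and D: "(x s, s) \<in> D"
    and f_x: "((\<lambda>y. f y s) has_vector_derivative fx (x s) s) (at (x s))"
    and f_t: "\<And>y t. (y, t) \<in> D \<Longrightarrow> ((\<lambda>t. f y t) has_vector_derivative ft y t) (at t)"
    and ft_cont: "continuous_on D (\<lambda>(y, t). ft y t)"
    and x: "(x has_vector_derivative x') (at s within S)"
  shows "((\<lambda>s. f (x s) s) has_vector_derivative x' *\<^sub>R fx (x s) s + ft (x s) s) (at s within S)"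
proof -
  obtain A B where AB: "open A" "open B" "(x s, s) \<in> A \<times> B" "A \<times> B \<subseteq> D"
    using \<open>open D\<close> D by (rule open_prod_elim)
  \<comment> \<open>The criterion by partial derivatives works on a product whose second factor is
    convex, hence the ball.\<close>
  then obtain e where e: "e > 0" "ball s e \<subseteq> B"
    by (auto elim: openE)
  let ?B = "ball s e"
  have sub: "A \<times> ?B \<subseteq> D" using AB e by auto
  have "((\<lambda>(y, t). f y t) has_derivative (\<lambda>(a, b). a *\<^sub>R fx (x s) s + blinfun_scaleR_left (ft (x s) s) b))
      (at (x s, s) within A \<times> ?B)"
  proof (rule has_derivative_partialsI[where fy = "\<lambda>y t. blinfun_scaleR_left (ft y t)"])
    show "((\<lambda>y. f y s) has_derivative (\<lambda>a. a *\<^sub>R fx (x s) s)) (at (x s) within A)"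
      using f_x unfolding has_vector_derivative_def by (rule has_derivative_at_withinI)
    show "((\<lambda>t. f y t) has_derivative blinfun_apply (blinfun_scaleR_left (ft y t))) (at t within ?B)"
      if "y \<in> A" "t \<in> ?B" for y t
    proof -
      have "(y, t) \<in> D" using that sub by auto
      from f_t[OF this] show ?thesis
        unfolding has_vector_derivative_def blinfun_scaleR_left.rep_eq by (rule has_derivative_at_withinI)
    qed
    have c: "continuous_on (A \<times> ?B) (\<lambda>p. ft (fst p) (snd p))"
      using continuous_on_subset[OF ft_cont sub] by (simp add: case_prod_unfold)
    have "continuous_on (A \<times> ?B) (\<lambda>p. blinfun_scaleR_left (ft (fst p) (snd p)))"
      by (intro continuous_intros c)
    then show "continuous (at (x s, s) within A \<times> ?B) (\<lambda>(y, t). blinfun_scaleR_left (ft y t))"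
      using AB e by (auto simp: continuous_on_eq_continuous_within case_prod_unfold)
    show "s \<in> ?B" "convex ?B" using e by auto
  qed
  moreover have "at (x s, s) within A \<times> ?B = at (x s, s)"
    using AB e by (intro at_within_open) (auto intro: open_Times)
  ultimately have d: "((\<lambda>(y, t). f y t) has_derivative (\<lambda>(a, b). a *\<^sub>R fx (x s) s + b *\<^sub>R ft (x s) s))
      (at (x s, s))" by simp
  have "((\<lambda>s. (x s, s)) has_derivative (\<lambda>h. (h *\<^sub>R x', h))) (at s within S)"
    using x unfolding has_vector_derivative_def by (intro has_derivative_Pair has_derivative_ident)
  from has_derivative_compose[OF this d] show ?thesis
    by (simp add: has_vector_derivative_def scaleR_add_right mult.commute)
qed

section \<open>The moving domain and its parametrisation by the unit interval\<close>

locale moving_domain =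
  fixes T :: real and l1 l2 l1' l2' :: "real \<Rightarrow> real"
    and q qx qt qxx :: "real \<Rightarrow> real \<Rightarrow> complex"
  assumes T_pos: "T > 0"
    and l1_deriv: "\<And>s. s \<in> {0..T} \<Longrightarrow> (l1 has_vector_derivative l1' s) (at s within {0..T})"
    and l2_deriv: "\<And>s. s \<in> {0..T} \<Longrightarrow> (l2 has_vector_derivative l2' s) (at s within {0..T})"
    and l1'_cont: "continuous_on {0..T} l1'" and l2'_cont: "continuous_on {0..T} l2'"
    and l_le: "l1 0 \<le> l2 0" and l_less: "\<And>s. s \<in> {0<..T} \<Longrightarrow> l1 s < l2 s"
    and q_t: "\<And>x t. (x, t) \<in> open_dom T l1 l2 \<Longrightarrow> ((\<lambda>s. q x s) has_vector_derivative qt x t) (at t)"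
    and qx_x: "\<And>x t. (x, t) \<in> open_dom T l1 l2 \<Longrightarrow> ((\<lambda>y. qx y t) has_vector_derivative qxx x t) (at x)"
    and schrodinger: "\<And>x t. (x, t) \<in> open_dom T l1 l2 \<Longrightarrow> \<i> * qt x t + qxx x t = 0"
    and qt_cont: "continuous_on (open_dom T l1 l2) (\<lambda>(x, t). qt x t)"
    and qxx_cont: "continuous_on (open_dom T l1 l2) (\<lambda>(x, t). qxx x t)"
    and q_x: "\<And>x t. (x, t) \<in> lateral_dom T l1 l2 \<Longrightarrow>
        ((\<lambda>y. q y t) has_vector_derivative qx x t) (at x within {l1 t..l2 t})"
    and qx_cont: "continuous_on (lateral_dom T l1 l2) (\<lambda>(x, t). qx x t)"
    and q_cont: "continuous_on (initial_dom T l1 l2) (\<lambda>(x, t). q x t)"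
begin

lemma l_cont: "continuous_on {0..T} l1" "continuous_on {0..T} l2"
  using has_vector_derivative_continuous[OF l1_deriv] has_vector_derivative_continuous[OF l2_deriv]
  by (auto simp: continuous_on_eq_continuous_within)

text \<open>For fixed \<open>s\<close> this is the affine map of the unit interval onto the slice
  between the boundaries; for fixed \<open>y\<close> it is a curve interpolating between them, with
  velocity \<open>X' y s\<close> (the prime is the derivative in \<open>s\<close>).\<close>

definition X :: "real \<Rightarrow> real \<Rightarrow> real" where "X y s = l1 s + y * (l2 s - l1 s)"
definition X' :: "real \<Rightarrow> real \<Rightarrow> real" where "X' y s = l1' s + y * (l2' s - l1' s)"

lemma X_0 [simp]: "X 0 s = l1 s" "X' 0 s = l1' s" and X_1 [simp]: "X 1 s = l2 s" "X' 1 s = l2' s"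
  by (auto simp: X_def X'_def)

lemma X_deriv: assumes "s \<in> {0<..<T}" shows "((\<lambda>s. X y s) has_vector_derivative X' y s) (at s)"
proof -
  have s: "s \<in> {0..T}" "at s within {0..T} = at s"
    using assms by (auto intro: at_within_interior)
  note d = l1_deriv[OF s(1)] l2_deriv[OF s(1)]
  show ?thesis unfolding X_def X'_def using d[unfolded s(2)]
    by (auto intro!: derivative_eq_intros)
qed

lemma l_le': "s \<in> {0..T} \<Longrightarrow> l1 s \<le> l2 s"
  using l_le l_less[of s] by (cases "s = 0") auto

lemma X_between: assumes "y \<in> {0..1}" "s \<in> {0..T}" shows "X y s \<in> {l1 s..l2 s}"
proof -
  have "0 \<le> y * (l2 s - l1 s)" using assms l_le' by auto
  moreover have "y * (l2 s - l1 s) \<le> 1 * (l2 s - l1 s)" using assms l_le' by (intro mult_right_mono) auto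
  ultimately show ?thesis by (auto simp: X_def)
qed

lemma X_initial: "y \<in> {0..1} \<Longrightarrow> s \<in> {0..<T} \<Longrightarrow> (X y s, s) \<in> initial_dom T l1 l2"
  using X_between[of y s] by (auto simp: initial_dom_def)

lemma X_lateral: "y \<in> {0..1} \<Longrightarrow> s \<in> {0<..<T} \<Longrightarrow> (X y s, s) \<in> lateral_dom T l1 l2"
  using X_between[of y s] by (auto simp: lateral_dom_def)

lemma X_open: assumes "y \<in> {0<..<1}" "s \<in> {0<..<T}" shows "(X y s, s) \<in> open_dom T l1 l2"
proof -
  have w: "l1 s < l2 s" using l_less assms by auto
  have "0 < y * (l2 s - l1 s)" using assms w by auto
  moreover have "y * (l2 s - l1 s) < 1 * (l2 s - l1 s)" using assms w by (intro mult_strict_right_mono) auto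
  ultimately show ?thesis using assms by (auto simp: X_def open_dom_def)
qed

lemma open_open_dom: "open (open_dom T l1 l2)"
proof -
  let ?S = "(UNIV :: real set) \<times> {0<..<T}"
  have S: "open ?S" by (auto intro: open_Times)
  have c: "continuous_on ?S (\<lambda>p. fst p - l1 (snd p))" "continuous_on ?S (\<lambda>p. l2 (snd p) - fst p)"
    by (auto intro!: continuous_intros continuous_on_compose2[OF l_cont(1)] continuous_on_compose2[OF l_cont(2)])
  have "open (?S \<inter> (\<lambda>p. fst p - l1 (snd p)) -` {0<..})" "open (?S \<inter> (\<lambda>p. l2 (snd p) - fst p) -` {0<..})"
    using continuous_open_preimage[OF c(1) S] continuous_open_preimage[OF c(2) S] by auto
  then have "open ((?S \<inter> (\<lambda>p. fst p - l1 (snd p)) -` {0<..}) \<inter> (?S \<inter> (\<lambda>p. l2 (snd p) - fst p) -` {0<..}))"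
    by (rule open_Int)
  also have "\<dots> = open_dom T l1 l2" by (auto simp: open_dom_def)
  finally show ?thesis .
qed

lemma open_dom_lateral: "open_dom T l1 l2 \<subseteq> lateral_dom T l1 l2"
  by (auto simp: open_dom_def lateral_dom_def)

lemma q_x_open: assumes "(x, t) \<in> open_dom T l1 l2"
  shows "((\<lambda>y. q y t) has_vector_derivative qx x t) (at x)"
proof -
  have "at x within {l1 t..l2 t} = at x"
    using assms by (intro at_within_interior) (auto simp: open_dom_def)
  then show ?thesis using q_x[of x t] assms open_dom_lateral by auto
qed

lemmas q_cont' = continuous_on_Pair_compose[OF q_cont]
lemmas qx_cont' = continuous_on_Pair_compose[OF qx_cont]
lemmas qxx_cont' = continuous_on_Pair_compose[OF qxx_cont]

lemmas l_cont' = continuous_on_compose2[OF l_cont(1)] continuous_on_compose2[OF l_cont(2)]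
  continuous_on_compose2[OF l1'_cont] continuous_on_compose2[OF l2'_cont]

lemma X_cont': assumes "continuous_on A f" "continuous_on A g" "g ` A \<subseteq> {0..T}"
  shows "continuous_on A (\<lambda>a. X (f a) (g a))" "continuous_on A (\<lambda>a. X' (f a) (g a))"
  unfolding X_def X'_def using assms by (auto intro!: continuous_intros l_cont')

end

text \<open>\<open>H\<close>, \<open>H1\<close>, \<open>H2\<close> are the first three
  \<open>x\<close>-derivatives of \<open>G\<close>. The derivatives in \<open>s\<close> encode the
  adjoint equation for \<open>G\<close> and for its \<open>x\<close>-derivative \<open>H\<close>,
  which is the multiplier in Green's formula.\<close>

locale backward_kernel =
  fixes G H H1 H2 :: "real \<Rightarrow> real \<Rightarrow> complex"
  assumes G_x: "\<And>x s. ((\<lambda>x. G x s) has_vector_derivative H x s) (at x)"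
    and H_x: "\<And>x s. ((\<lambda>x. H x s) has_vector_derivative H1 x s) (at x)"
    and H1_x: "\<And>x s. ((\<lambda>x. H1 x s) has_vector_derivative H2 x s) (at x)"
    and G_s: "\<And>x s. ((\<lambda>s. G x s) has_vector_derivative - \<i> * H1 x s) (at s)"
    and H_s: "\<And>x s. ((\<lambda>s. H x s) has_vector_derivative - \<i> * H2 x s) (at s)"
    and G_cont: "continuous_on UNIV (\<lambda>(x, s). G x s)"
    and H_cont: "continuous_on UNIV (\<lambda>(x, s). H x s)"
    and H1_cont: "continuous_on UNIV (\<lambda>(x, s). H1 x s)"
    and H2_cont: "continuous_on UNIV (\<lambda>(x, s). H2 x s)"
begin

lemmas kernel_cont =
  continuous_on_Pair_compose[OF G_cont, OF _ _ UNIV_I]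
  continuous_on_Pair_compose[OF H_cont, OF _ _ UNIV_I]
  continuous_on_Pair_compose[OF H1_cont, OF _ _ UNIV_I]
  continuous_on_Pair_compose[OF H2_cont, OF _ _ UNIV_I]

lemma G_curve:
  assumes "(x has_vector_derivative x') (at s within S)"
  shows "((\<lambda>s. G (x s) s) has_vector_derivative x' *\<^sub>R H (x s) s - \<i> * H1 (x s) s) (at s within S)"
proof -
  have "continuous_on UNIV (\<lambda>(x, s). - \<i> * H1 x s)"
    by (auto simp: case_prod_unfold intro!: continuous_intros kernel_cont)
  from has_vector_derivative_along_curve[where f = G and fx = H and D = UNIV,
      OF open_UNIV UNIV_I G_x G_s this assms]
  show ?thesis by simp
qed

lemma H_curve:
  assumes "(x has_vector_derivative x') (at s within S)"
  shows "((\<lambda>s. H (x s) s) has_vector_derivative x' *\<^sub>R H1 (x s) s - \<i> * H2 (x s) s) (at s within S)"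
proof -
  have "continuous_on UNIV (\<lambda>(x, s). - \<i> * H2 x s)"
    by (auto simp: case_prod_unfold intro!: continuous_intros kernel_cont)
  from has_vector_derivative_along_curve[where f = H and fx = H1 and D = UNIV,
      OF open_UNIV UNIV_I H_x H_s this assms]
  show ?thesis by simp
qed

end

section \<open>The conservation law and its integrated form\<close>

locale green = moving_domain + backward_kernel
begin

text \<open>Everything is pulled back by \<open>y \<mapsto> X y s\<close> to the fixed interval \<open>{0..1}\<close>. The conservation law is that
  \<open>mass_deriv\<close> is both the \<open>s\<close>-derivative of \<open>mass\<close> and the \<open>y\<close>-derivative of \<open>flux\<close>.\<close>

definition mass :: "real \<Rightarrow> real \<Rightarrow> complex" where
  "mass y s = (l2 s - l1 s) *\<^sub>R (q (X y s) s * H (X y s) s)"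

text \<open>The first summand is the transport through a curve moving with velocity
  \<open>X'\<close>; the second is the current in
  \<open>(q H)\<^sub>s = \<i> (H q\<^sub>x - q H\<^sub>x)\<^sub>x\<close>.\<close>

definition flux :: "real \<Rightarrow> real \<Rightarrow> complex" where
  "flux y s = X' y s *\<^sub>R (q (X y s) s * H (X y s) s)
     + \<i> * (H (X y s) s * qx (X y s) s - q (X y s) s * H1 (X y s) s)"

definition mass_deriv :: "real \<Rightarrow> real \<Rightarrow> complex" where
  "mass_deriv y s = (l2' s - l1' s) *\<^sub>R (q (X y s) s * H (X y s) s)
     + (l2 s - l1 s) *\<^sub>R (X' y s *\<^sub>R (qx (X y s) s * H (X y s) s + q (X y s) s * H1 (X y s) s)
       + \<i> * (H (X y s) s * qxx (X y s) s - q (X y s) s * H2 (X y s) s))"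

lemma X_y: "((\<lambda>y. X y s) has_vector_derivative (l2 s - l1 s)) (at y)"
  "((\<lambda>y. X' y s) has_vector_derivative (l2' s - l1' s)) (at y)"
  unfolding X_def X'_def by (auto intro!: derivative_eq_intros)

lemma chain_X:
  assumes "((\<lambda>x. f x s) has_vector_derivative f') (at (X y s))"
  shows "((\<lambda>y. f (X y s) s) has_vector_derivative (l2 s - l1 s) *\<^sub>R f') (at y)"
  using vector_diff_chain_at[OF X_y(1) assms] by (simp add: o_def)

text \<open>The two products of \<open>qx\<close> with \<open>H1\<close> that arise from the current
  cancel, so only \<open>H * qxx - q * H2\<close> is left of it.\<close>

lemma flux_deriv:
  assumes "y \<in> {0<..<1}" "s \<in> {0<..<T}"
  shows "((\<lambda>y. flux y s) has_vector_derivative mass_deriv y s) (at y)"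
proof -
  note o = X_open[OF assms]
  note d = chain_X[where f = q, OF q_x_open[OF o]] chain_X[where f = qx, OF qx_x[OF o]]
    chain_X[where f = H, OF H_x] chain_X[where f = H1, OF H1_x] X_y(2)[folded has_real_derivative_iff_has_vector_derivative]
  \<comment> \<open>The rules first synthesise a derivative in the shape they produce; algebra then
    identifies it with \<open>mass_deriv\<close>.\<close>
  show ?thesis unfolding flux_def mass_deriv_def
    apply (rule back_subst[where P = "\<lambda>d. (_ has_vector_derivative d) _"])
     apply (rule has_vector_derivative_add has_vector_derivative_diff has_vector_derivative_mult_right
        has_vector_derivative_mult has_vector_derivative_scaleR d)+
    apply (simp add: algebra_simps scaleR_conv_of_real)
    done
qed

lemma q_curve:
  assumes "(x s, s) \<in> open_dom T l1 l2" "(x has_vector_derivative x') (at s within S)"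
  shows "((\<lambda>s. q (x s) s) has_vector_derivative x' *\<^sub>R qx (x s) s + qt (x s) s) (at s within S)"
  by (rule has_vector_derivative_along_curve[where f = q and fx = qx and ft = qt,
      OF open_open_dom assms(1) q_x_open[OF assms(1)] q_t qt_cont assms(2)])

text \<open>The equation for \<open>q\<close> and the adjoint equation for \<open>H\<close> trade
  the time derivatives for \<open>qxx\<close> and \<open>H2\<close>; the motion of the curve
  contributes the terms with \<open>X'\<close>.\<close>

lemma mass_deriv:
  assumes "y \<in> {0<..<1}" "s \<in> {0<..<T}"
  shows "((\<lambda>s. mass y s) has_vector_derivative mass_deriv y s) (at s)"
proof -
  note o = X_open[OF assms]
  note X = X_deriv[OF assms(2), of y]
  have w: "((\<lambda>s. l2 s - l1 s) has_vector_derivative l2' s - l1' s) (at s)"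
    using has_vector_derivative_diff[OF X_deriv[OF assms(2), of 1] X_deriv[OF assms(2), of 0]] by simp
  have "qxx (X y s) s = - (\<i> * qt (X y s) s)"
    using schrodinger[OF o] by (metis add_eq_0_iff add.commute)
  then have qt: "qt (X y s) s = \<i> * qxx (X y s) s" by simp
  note d = q_curve[OF o X] H_curve[OF X] w[folded has_real_derivative_iff_has_vector_derivative]
  show ?thesis unfolding mass_def mass_deriv_def
    apply (rule back_subst[where P = "\<lambda>d. (_ has_vector_derivative d) _"])
     apply (rule has_vector_derivative_add has_vector_derivative_diff has_vector_derivative_mult_right
        has_vector_derivative_mult has_vector_derivative_scaleR d)+
    apply (simp add: algebra_simps scaleR_conv_of_real qt)
    done
qed

text \<open>The regions of this and the next two lemmas shrink with the regularity at hand: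
  \<open>q\<close> reaches the sides and the initial segment, \<open>qx\<close> only the sides,
  \<open>qxx\<close> neither.\<close>

lemma mass_cont: "continuous_on ({0..1} \<times> {0..<T}) (\<lambda>(y, s). mass y s)"
  unfolding mass_def case_prod_unfold
  by (auto intro!: continuous_intros l_cont' q_cont' kernel_cont X_cont' X_initial)

lemma flux_cont: "continuous_on ({0..1} \<times> {0<..<T}) (\<lambda>(y, s). flux y s)"
  unfolding flux_def case_prod_unfold
  by (auto intro!: continuous_intros l_cont' q_cont' qx_cont' kernel_cont X_cont' X_initial X_lateral)

lemma mass_deriv_cont: "continuous_on ({0<..<1} \<times> {0<..<T}) (\<lambda>(y, s). mass_deriv y s)"
  unfolding mass_deriv_def case_prod_unfold
  by (auto intro!: continuous_intros l_cont' q_cont' qx_cont' qxx_cont' kernel_cont X_cont' X_initial X_lateral X_open)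

text \<open>Only inner curves are admissible at first: \<open>qt\<close> and \<open>qxx\<close> need not extend to the boundary, and
  \<open>qx\<close> need not extend to the initial segment.\<close>

lemma green_inner:
  assumes \<delta>: "0 < \<delta>" "\<delta> \<le> 1 / 2" and \<sigma>: "0 < \<sigma>" "\<sigma> \<le> b" "b < T"
  shows "integral {\<delta>..1-\<delta>} (\<lambda>y. mass y b) - integral {\<delta>..1-\<delta>} (\<lambda>y. mass y \<sigma>)
    = integral {\<sigma>..b} (flux (1 - \<delta>)) - integral {\<sigma>..b} (flux \<delta>)"
proof -
  \<comment> \<open>Differentiation under the integral sign gives the integral of
    \<open>mass_deriv\<close>, which the fundamental theorem in \<open>y\<close> turns into a
    difference of fluxes. Integration in \<open>s\<close> then completes the proof.\<close>
  have "((\<lambda>s. integral {\<delta>..1-\<delta>} (\<lambda>y. mass y s)) has_vector_derivative flux (1-\<delta>) s - flux \<delta> s)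
      (at s within {\<sigma>..b})" if s: "s \<in> {\<sigma>..b}" for s
  proof -
    have "((\<lambda>s. integral (cbox \<delta> (1-\<delta>)) (\<lambda>y. mass y s)) has_vector_derivative
        integral (cbox \<delta> (1-\<delta>)) (\<lambda>y. mass_deriv y s)) (at s within {\<sigma>..b})"
    proof (rule leibniz_rule_vector_derivative)
      show "((\<lambda>s. mass y s) has_vector_derivative mass_deriv y s) (at s within {\<sigma>..b})"
        if "s \<in> {\<sigma>..b}" "y \<in> cbox \<delta> (1-\<delta>)" for s y
        using that \<delta> \<sigma> by (intro has_vector_derivative_at_within[OF mass_deriv]) auto
      show "(\<lambda>y. mass y s) integrable_on cbox \<delta> (1 - \<delta>)" if "s \<in> {\<sigma>..b}" for s
        using that \<delta> \<sigma> by (intro integrable_continuous continuous_on_Pair_compose[OF mass_cont])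
          (auto intro!: continuous_intros)
      show "continuous_on ({\<sigma>..b} \<times> cbox \<delta> (1 - \<delta>)) (\<lambda>(s, y). mass_deriv y s)"
        unfolding case_prod_unfold using \<delta> \<sigma>
        by (intro continuous_on_Pair_compose[OF mass_deriv_cont]) (auto intro!: continuous_intros)
    qed (use s in auto)
    moreover have "((\<lambda>y. mass_deriv y s) has_integral flux (1-\<delta>) s - flux \<delta> s) {\<delta>..1-\<delta>}"
      using s \<delta> \<sigma>
      by (intro fundamental_theorem_of_calculus has_vector_derivative_at_within[OF flux_deriv]) auto
    ultimately show ?thesis by (simp add: integral_unique)
  qed
  then have "((\<lambda>s. flux (1-\<delta>) s - flux \<delta> s) has_integral
      integral {\<delta>..1-\<delta>} (\<lambda>y. mass y b) - integral {\<delta>..1-\<delta>} (\<lambda>y. mass y \<sigma>)) {\<sigma>..b}"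
    using \<sigma> by (intro fundamental_theorem_of_calculus) auto
  moreover have "flux y integrable_on {\<sigma>..b}" if "y \<in> {0..1}" for y
    using that \<sigma> by (intro integrable_continuous_interval continuous_on_Pair_compose[OF flux_cont])
      (auto intro!: continuous_intros)
  ultimately show ?thesis
    using \<delta> by (simp add: integral_unique flip: Henstock_Kurzweil_Integration.integral_diff)
qed

text \<open>The limit \<delta> \<rightarrow> 0 of \<open>green_inner\<close>: the defect \<Phi>
  vanishes on \<open>{0<..1/2}\<close> and is continuous on the closure, so it vanishes at
  0.\<close>

lemma green_lateral:
  assumes \<sigma>: "0 < \<sigma>" "\<sigma> \<le> b" "b < T"
  shows "integral {0..1} (\<lambda>y. mass y b) - integral {0..1} (\<lambda>y. mass y \<sigma>)
    = integral {\<sigma>..b} (flux 1) - integral {\<sigma>..b} (flux 0)"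
proof -
  define \<Phi> where "\<Phi> \<delta> = integral {\<delta>..1-\<delta>} (\<lambda>y. mass y b) - integral {\<delta>..1-\<delta>} (\<lambda>y. mass y \<sigma>)
    - (integral {\<sigma>..b} (flux (1 - \<delta>)) - integral {\<sigma>..b} (flux \<delta>))" for \<delta>
  have cl: "closure {0<..1/2::real} = {0..1/2}" by (intro closure_greaterThanAtMost) auto
  have int: "(\<lambda>y. mass y s) integrable_on {0..1}" if "s \<in> {\<sigma>..b}" for s
    using that \<sigma> by (intro integrable_continuous_interval continuous_on_Pair_compose[OF mass_cont])
      (auto intro!: continuous_intros)
  have cI: "continuous_on {0..1/2} (\<lambda>\<delta>. integral {\<delta>..1-\<delta>} (\<lambda>y. mass y s))" if s: "s \<in> {\<sigma>..b}" for s
  proof -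
    note c = indefinite_integral_continuous_1[OF int[OF s]]
    \<comment> \<open>With both limits of integration moving, the integral is written as a
      difference of two values of one indefinite integral.\<close>
    have eq: "integral {\<delta>..1-\<delta>} (\<lambda>y. mass y s)
        = integral {0..1-\<delta>} (\<lambda>y. mass y s) - integral {0..\<delta>} (\<lambda>y. mass y s)" if "\<delta> \<in> {0..1/2}" for \<delta>
    proof -
      have "integral {0..\<delta>} (\<lambda>y. mass y s) + integral {\<delta>..1-\<delta>} (\<lambda>y. mass y s)
        = integral {0..1-\<delta>} (\<lambda>y. mass y s)"
        using that by (intro Henstock_Kurzweil_Integration.integral_combine
            integrable_on_subinterval[OF int[OF s]]) auto
      then show ?thesis by (simp add: algebra_simps)
    qed
    have "continuous_on {0..1/2} (\<lambda>\<delta>. integral {0..1-\<delta>} (\<lambda>y. mass y s) - integral {0..\<delta>} (\<lambda>y. mass y s))"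
      by (intro continuous_intros continuous_on_compose2[OF c]) auto
    then show ?thesis using eq by (simp cong: continuous_on_cong_simp)
  qed
  have cf: "continuous_on {0..1} (\<lambda>y. integral {\<sigma>..b} (flux y))"
    using integral_continuous_on_param[of "{0..1}" \<sigma> b flux] continuous_on_subset[OF flux_cont, of "{0..1} \<times> {\<sigma>..b}"] \<sigma>
    by fastforce
  have "\<Phi> 0 = 0"
  proof (rule continuous_constant_on_closure[where S = "{0<..1/2}" and f = \<Phi>])
    show "continuous_on (closure {0<..1/2}) \<Phi>"
      unfolding cl \<Phi>_def using \<sigma>
      by (intro continuous_intros cI continuous_on_compose2[OF cf]) auto
    show "\<Phi> \<delta> = 0" if "\<delta> \<in> {0<..1/2}" for \<delta>
      using green_inner[of \<delta> \<sigma> b] that \<sigma> by (simp add: \<Phi>_def)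
  qed (simp add: cl)
  then show ?thesis by (simp add: \<Phi>_def)
qed

end

section \<open>Integration by parts along the sides, and the global relation\<close>

context backward_kernel
begin

text \<open>In the boundary flux, the factor of \<open>u\<close> is the derivative of
  \<open>G\<close> along the boundary curve. Integration by parts moves this derivative to the
  Dirichlet value \<open>u\<close> and removes \<open>H1\<close>.\<close>

lemma boundary_by_parts:
  assumes "0 \<le> t" "t \<le> T"
    and l: "\<And>s. s \<in> {0..T} \<Longrightarrow> (l has_vector_derivative l' s) (at s within {0..T})"
    and l'_cont: "continuous_on {0..T} l'"
    and u: "\<And>s. s \<in> {0..T} \<Longrightarrow> (u has_vector_derivative u' s) (at s within {0..T})"
    and u'_cont: "continuous_on {0..T} u'" and v_cont: "continuous_on {0..T} v"
  shows "integral {0..t} (\<lambda>s. l' s *\<^sub>R (u s * H (l s) s) + \<i> * (H (l s) s * v s - u s * H1 (l s) s))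
    = u t * G (l t) t - u 0 * G (l 0) 0 - integral {0..t} (\<lambda>s. u' s * G (l s) s - \<i> * (H (l s) s * v s))"
    (is "integral _ ?B = _ - integral _ ?C")
proof -
  have sub: "{0..t} \<subseteq> {0..T}" using assms by auto
  have cont: "continuous_on {0..T} l" "continuous_on {0..T} u"
    using has_vector_derivative_continuous[OF l] has_vector_derivative_continuous[OF u]
    by (auto simp: continuous_on_eq_continuous_within)
  note c = continuous_on_subset[OF _ sub]
  note cs = c[OF l'_cont] c[OF cont(1)] c[OF cont(2)] c[OF u'_cont] c[OF v_cont]
  have int: "?B integrable_on {0..t}" "?C integrable_on {0..t}"
    by (auto intro!: integrable_continuous_interval continuous_intros kernel_cont cs)
  have "((\<lambda>s. u s * (l' s *\<^sub>R H (l s) s - \<i> * H1 (l s) s) + u' s * G (l s) s) has_integral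
      u t * G (l t) t - u 0 * G (l 0) 0) {0..t}"
  proof (intro fundamental_theorem_of_calculus \<open>0 \<le> t\<close>)
    fix s assume "s \<in> {0..t}"
    then have s: "s \<in> {0..T}" using sub by auto
    note d = G_curve[OF has_vector_derivative_within_subset[OF l[OF s] sub]]
      has_vector_derivative_within_subset[OF u[OF s] sub]
    show "((\<lambda>s. u s * G (l s) s) has_vector_derivative
        u s * (l' s *\<^sub>R H (l s) s - \<i> * H1 (l s) s) + u' s * G (l s) s) (at s within {0..t})"
      by (rule has_vector_derivative_mult d)+
  qed
  moreover have "u s * (l' s *\<^sub>R H (l s) s - \<i> * H1 (l s) s) + u' s * G (l s) s = ?B s + ?C s" for s
    by (simp add: algebra_simps)
  ultimately have "((\<lambda>s. ?B s + ?C s) has_integral u t * G (l t) t - u 0 * G (l 0) 0) {0..t}"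
    by simp
  then have "integral {0..t} ?B + integral {0..t} ?C = u t * G (l t) t - u 0 * G (l 0) 0"
    using Henstock_Kurzweil_Integration.integral_add[OF int] by (simp add: integral_unique)
  then show ?thesis by (simp add: algebra_simps)
qed

end

context green
begin

text \<open>The limit \<sigma> \<rightarrow> 0 of \<open>green_lateral\<close>. The boundary fluxes
  are replaced by functions that agree with them for positive times and are continuous up to time
  0.\<close>

lemma green_initial:
  assumes t: "t \<in> {0<..<T}"
    and B: "continuous_on {0..t} B0" "continuous_on {0..t} B1"
    and eq: "\<And>s. s \<in> {0<..t} \<Longrightarrow> flux 0 s = B0 s" "\<And>s. s \<in> {0<..t} \<Longrightarrow> flux 1 s = B1 s"
  shows "integral {0..1} (\<lambda>y. mass y t) - integral {0..1} (\<lambda>y. mass y 0)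
    = integral {0..t} B1 - integral {0..t} B0"
proof -
  define \<Phi> where "\<Phi> \<sigma> = integral {0..1} (\<lambda>y. mass y t) - integral {0..1} (\<lambda>y. mass y \<sigma>)
    - (integral {\<sigma>..t} B1 - integral {\<sigma>..t} B0)" for \<sigma>
  have cl: "closure {0<..t} = {0..t}" using t by (intro closure_greaterThanAtMost) auto
  have "continuous_on {0..t} (\<lambda>s. integral (cbox 0 1) (\<lambda>y. mass y s))"
    using t by (intro integral_continuous_on_param)
      (auto simp: case_prod_unfold intro!: continuous_on_Pair_compose[OF mass_cont] continuous_intros)
  then have cI: "continuous_on {0..t} (\<lambda>s. integral {0..1} (\<lambda>y. mass y s))" by simp
  have "\<Phi> 0 = 0"
  proof (rule continuous_constant_on_closure[where S = "{0<..t}" and f = \<Phi>])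
    show "continuous_on (closure {0<..t}) \<Phi>"
      unfolding cl \<Phi>_def
      by (intro continuous_intros cI indefinite_integral_continuous_1' integrable_continuous_interval B)
    show "\<Phi> \<sigma> = 0" if \<sigma>: "\<sigma> \<in> {0<..t}" for \<sigma>
    proof -
      have "integral {\<sigma>..t} (flux 0) = integral {\<sigma>..t} B0" "integral {\<sigma>..t} (flux 1) = integral {\<sigma>..t} B1"
        using \<sigma> by (auto intro!: integral_cong eq)
      then show ?thesis using green_lateral[of \<sigma> t] \<sigma> t by (simp add: \<Phi>_def)
    qed
  qed (use t in \<open>simp add: cl\<close>)
  then show ?thesis by (simp add: \<Phi>_def)
qed

text \<open>Since \<open>H\<close> is the \<open>x\<close>-derivative of \<open>G\<close>,
  integration by parts over the slice moves the derivative to \<open>q\<close> and leaves the values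
  at the two end points.\<close>

lemma mass_by_parts:
  assumes t: "t \<in> {0<..<T}"
  shows "integral {0..1} (\<lambda>y. mass y t) = q (l2 t) t * G (l2 t) t - q (l1 t) t * G (l1 t) t
    - integral {0..1} (\<lambda>y. (l2 t - l1 t) *\<^sub>R (qx (X y t) t * G (X y t) t))"
proof -
  let ?C = "\<lambda>y. (l2 t - l1 t) *\<^sub>R (qx (X y t) t * G (X y t) t)"
  have int: "(\<lambda>y. mass y t) integrable_on {0..1}" "?C integrable_on {0..1}"
    using t by (auto intro!: integrable_continuous_interval continuous_intros kernel_cont qx_cont' X_cont'
        X_lateral continuous_on_Pair_compose[OF mass_cont])
  have "((\<lambda>y. q (X y t) t * ((l2 t - l1 t) *\<^sub>R H (X y t) t) + (l2 t - l1 t) *\<^sub>R qx (X y t) t * G (X y t) t)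
      has_integral q (X 1 t) t * G (X 1 t) t - q (X 0 t) t * G (X 0 t) t) {0..1}"
  proof (rule fundamental_theorem_of_calculus_interior)
    show "continuous_on {0..1} (\<lambda>y. q (X y t) t * G (X y t) t)"
      using t by (auto intro!: continuous_intros kernel_cont q_cont' X_cont' X_initial)
    fix y :: real assume "y \<in> {0<..<1}"
    then have o: "(X y t, t) \<in> open_dom T l1 l2" using X_open t by auto
    note d = chain_X[where f = q, OF q_x_open[OF o]] chain_X[where f = G, OF G_x]
    show "((\<lambda>y. q (X y t) t * G (X y t) t) has_vector_derivative
        q (X y t) t * ((l2 t - l1 t) *\<^sub>R H (X y t) t) + (l2 t - l1 t) *\<^sub>R qx (X y t) t * G (X y t) t) (at y)"
      by (rule has_vector_derivative_mult d)+
  qed simp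
  moreover have "q (X y t) t * ((l2 t - l1 t) *\<^sub>R H (X y t) t) + (l2 t - l1 t) *\<^sub>R qx (X y t) t * G (X y t) t
      = mass y t + ?C y" for y
    by (simp add: mass_def)
  ultimately have "((\<lambda>y. mass y t + ?C y) has_integral q (l2 t) t * G (l2 t) t - q (l1 t) t * G (l1 t) t) {0..1}"
    by simp
  then show ?thesis
    using Henstock_Kurzweil_Integration.integral_add[OF int] by (simp add: integral_unique algebra_simps)
qed

text \<open>The analogue of \<open>mass_by_parts\<close> at time 0, where the derivative of the
  initial datum takes the place of \<open>qx\<close>.\<close>

lemma mass_initial_by_parts:
  assumes q0: "\<And>x. x \<in> {l1 0..l2 0} \<Longrightarrow> (q0 has_vector_derivative q0' x) (at x within {l1 0..l2 0})"
    and q0'_cont: "continuous_on {l1 0..l2 0} q0'"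
    and eq: "\<And>x. x \<in> {l1 0<..<l2 0} \<Longrightarrow> q x 0 = q0 x"
  shows "integral {0..1} (\<lambda>y. mass y 0) = q (l2 0) 0 * G (l2 0) 0 - q (l1 0) 0 * G (l1 0) 0
    - integral {l1 0..l2 0} (\<lambda>x. q0' x * G x 0)"
proof (cases "l1 0 = l2 0")
  \<comment> \<open>On a degenerate segment the factor \<open>l2 0 - l1 0\<close> of
    \<open>mass\<close> vanishes and the two end point terms coincide.\<close>
  case True
  then show ?thesis by (simp add: mass_def X_def)
next
  case False
  then have less: "l1 0 < l2 0" using l_le by simp
  let ?S = "{l1 0..l2 0}"
  have q0_cont: "continuous_on ?S q0"
    using has_vector_derivative_continuous[OF q0] by (auto simp: continuous_on_eq_continuous_within)
  have q_cont0: "continuous_on ?S (\<lambda>x. q x 0)"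
    using T_pos by (intro q_cont') (auto simp: initial_dom_def)
  \<comment> \<open>The initial condition is given on the open interval; continuity extends it to
    the end points.\<close>
  have eq': "q x 0 = q0 x" if "x \<in> ?S" for x
  proof -
    have "continuous_on ?S (\<lambda>x. q x 0 - q0 x)"
      by (intro continuous_intros q_cont0 q0_cont)
    then have "q x 0 - q0 x = 0"
      using that less continuous_constant_on_closure[of "{l1 0<..<l2 0}" "\<lambda>x. q x 0 - q0 x" 0 x]
      by (auto simp: eq)
    then show ?thesis by simp
  qed
  have c: "continuous_on ?S (\<lambda>x. q0 x * H x 0)" "continuous_on ?S (\<lambda>x. q0' x * G x 0)"
    by (intro continuous_intros kernel_cont q0_cont q0'_cont)+
  \<comment> \<open>The substitution \<open>x = X y 0\<close> returns to the original variable, in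
    which \<open>q0\<close> is differentiated.\<close>
  have "((\<lambda>y. (l2 0 - l1 0) *\<^sub>R (q0 (X y 0) * H (X y 0) 0)) has_integral
      integral {X 0 0..X 1 0} (\<lambda>x. q0 x * H x 0)) {0..1}"
  proof (rule has_integral_substitution[OF _ _ _ c(1)])
    show "((\<lambda>y. X y 0) has_real_derivative l2 0 - l1 0) (at y within {0..1})" for y
      using X_y(1)[of 0 y]
      unfolding has_real_derivative_iff_has_vector_derivative by (rule has_vector_derivative_at_within)
    show "(\<lambda>y. X y 0) ` {0..1} \<subseteq> ?S" using X_between T_pos by auto
  qed (use l_le in auto)
  moreover have "mass y 0 = (l2 0 - l1 0) *\<^sub>R (q0 (X y 0) * H (X y 0) 0)" if "y \<in> {0..1}" for y
    using eq' X_between[OF that, of 0] T_pos by (simp add: mass_def)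
  ultimately have "integral {0..1} (\<lambda>y. mass y 0) = integral ?S (\<lambda>x. q0 x * H x 0)"
    by (metis (no_types, lifting) X_0(1) X_1(1) integral_cong integral_unique)
  moreover have "((\<lambda>x. q0 x * H x 0 + q0' x * G x 0) has_integral
      q0 (l2 0) * G (l2 0) 0 - q0 (l1 0) * G (l1 0) 0) ?S"
    using l_le by (intro fundamental_theorem_of_calculus has_vector_derivative_mult q0
        has_vector_derivative_at_within[OF G_x]) auto
  then have "integral ?S (\<lambda>x. q0 x * H x 0) + integral ?S (\<lambda>x. q0' x * G x 0)
      = q0 (l2 0) * G (l2 0) 0 - q0 (l1 0) * G (l1 0) 0"
    using Henstock_Kurzweil_Integration.integral_add[OF c[THEN integrable_continuous_interval]]
    by (simp add: integral_unique)
  ultimately show ?thesis using l_le by (simp add: eq' algebra_simps)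
qed

text \<open>The Dirichlet conditions hold for positive times only; continuity of \<open>q\<close> at
  the corners extends them to time 0. This lets the corner terms of the sides cancel those of the
  initial segment.\<close>

lemma boundary_corner:
  assumes "y \<in> {0..1}" "continuous_on {0..T} u" "\<And>s. s \<in> {0<..<T} \<Longrightarrow> q (X y s) s = u s"
  shows "q (X y 0) 0 = u 0"
proof -
  \<comment> \<open>Any end point inside \<open>{0<..<T}\<close> would serve: \<open>q\<close> is
    known to be continuous for times below \<open>T\<close> only.\<close>
  have cl: "closure {0<..<T/2} = {0..T/2}" using T_pos by (intro closure_greaterThanLessThan) auto
  have "continuous_on {0..T/2} (\<lambda>s. q (X y s) s - u s)"
    using assms T_pos by (auto intro!: continuous_intros q_cont' X_cont' X_initial continuous_on_subset[OF assms(2)])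
  then have "q (X y 0) 0 - u 0 = 0"
    using continuous_constant_on_closure[of "{0<..<T/2}" "\<lambda>s. q (X y s) s - u s" 0 0] T_pos assms(3)
    unfolding cl by auto
  then show ?thesis by simp
qed

text \<open>Green's formula with all four sides integrated by parts. The values of
  \<open>q * G\<close> at the four corners cancel, and what remains contains only \<open>qx\<close>
  at time \<open>t\<close>, derivatives of the data, and Neumann values.\<close>

lemma global_relation:
  assumes t: "t \<in> {0<..<T}"
    and q0: "\<And>x. x \<in> {l1 0..l2 0} \<Longrightarrow> (q0 has_vector_derivative q0' x) (at x within {l1 0..l2 0})"
    and q0'_cont: "continuous_on {l1 0..l2 0} q0'"
    and q0_eq: "\<And>x. x \<in> {l1 0<..<l2 0} \<Longrightarrow> q x 0 = q0 x"
    and f0: "\<And>s. s \<in> {0..T} \<Longrightarrow> (f0 has_vector_derivative f0' s) (at s within {0..T})"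
    and f0'_cont: "continuous_on {0..T} f0'" and f1_cont: "continuous_on {0..T} f1"
    and g0: "\<And>s. s \<in> {0..T} \<Longrightarrow> (g0 has_vector_derivative g0' s) (at s within {0..T})"
    and g0'_cont: "continuous_on {0..T} g0'" and g1_cont: "continuous_on {0..T} g1"
    and f_eq: "\<And>s. s \<in> {0<..<T} \<Longrightarrow> q (l1 s) s = f0 s" "\<And>s. s \<in> {0<..<T} \<Longrightarrow> qx (l1 s) s = f1 s"
    and g_eq: "\<And>s. s \<in> {0<..<T} \<Longrightarrow> q (l2 s) s = g0 s" "\<And>s. s \<in> {0<..<T} \<Longrightarrow> qx (l2 s) s = g1 s"
  shows "integral {0..1} (\<lambda>y. (l2 t - l1 t) *\<^sub>R (qx (X y t) t * G (X y t) t))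
    = integral {l1 0..l2 0} (\<lambda>x. q0' x * G x 0)
      + integral {0..t} (\<lambda>s. g0' s * G (l2 s) s - \<i> * (H (l2 s) s * g1 s))
      - integral {0..t} (\<lambda>s. f0' s * G (l1 s) s - \<i> * (H (l1 s) s * f1 s))"
proof -
  have cont: "continuous_on {0..T} f0" "continuous_on {0..T} g0"
    using has_vector_derivative_continuous[OF f0] has_vector_derivative_continuous[OF g0]
    by (auto simp: continuous_on_eq_continuous_within)
  have T: "0 \<le> t" "t \<le> T" and sub: "{0..t} \<subseteq> {0..T}" using t by auto
  note cs = continuous_on_subset[OF f0'_cont sub] continuous_on_subset[OF f1_cont sub]
    continuous_on_subset[OF g0'_cont sub] continuous_on_subset[OF g1_cont sub]
    continuous_on_subset[OF cont(1) sub] continuous_on_subset[OF cont(2) sub]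
    continuous_on_subset[OF l_cont(1) sub] continuous_on_subset[OF l_cont(2) sub]
    continuous_on_subset[OF l1'_cont sub] continuous_on_subset[OF l2'_cont sub]
  have corner: "q (l1 0) 0 = f0 0" "q (l2 0) 0 = g0 0"
    using boundary_corner[of 0 f0] boundary_corner[of 1 g0] cont f_eq g_eq by auto
  let ?B0 = "\<lambda>s. l1' s *\<^sub>R (f0 s * H (l1 s) s) + \<i> * (H (l1 s) s * f1 s - f0 s * H1 (l1 s) s)"
  let ?B1 = "\<lambda>s. l2' s *\<^sub>R (g0 s * H (l2 s) s) + \<i> * (H (l2 s) s * g1 s - g0 s * H1 (l2 s) s)"
  have "integral {0..1} (\<lambda>y. mass y t) - integral {0..1} (\<lambda>y. mass y 0)
    = integral {0..t} ?B1 - integral {0..t} ?B0"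
    using t f_eq g_eq by (intro green_initial) (auto simp: flux_def intro!: continuous_intros kernel_cont cs)
  also note boundary_by_parts[OF T l1_deriv l1'_cont f0 f0'_cont f1_cont]
  also note boundary_by_parts[OF T l2_deriv l2'_cont g0 g0'_cont g1_cont]
  also note mass_by_parts[OF t]
  also note mass_initial_by_parts[OF q0 q0'_cont q0_eq]
  finally show ?thesis
    using t f_eq g_eq corner by (simp add: algebra_simps)
qed

end

section \<open>Limits of layer potentials\<close>

lemma norm_csqrt: "norm (csqrt z) = sqrt (norm z)"
proof -
  have "(norm (csqrt z))\<^sup>2 = norm z" by (metis norm_power power2_csqrt)
  then show ?thesis by (metis norm_ge_zero real_sqrt_abs abs_of_nonneg)
qed

text \<open>In the closed lower half plane the real part of \<i> / z is nonpositive, so the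
  exponential has modulus at most 1. The bound is uniform in \<open>y\<close>.\<close>

lemma norm_skernel_le:
  assumes "Im z \<le> 0"
  shows "norm (skernel z (of_real y)) \<le> 1 / sqrt (norm z)"
proof -
  have "\<i> * (of_real y)\<^sup>2 / (4 * z) = of_real (y\<^sup>2 / 4) * (\<i> / z)" by simp
  also have "Re \<dots> = y\<^sup>2 / 4 * Re (\<i> / z)"
    by (simp only: times_complex.sel Re_complex_of_real Im_complex_of_real mult_zero_left diff_zero)
  also have "Re (\<i> / z) = Im z / ((Re z)\<^sup>2 + (Im z)\<^sup>2)" by (simp add: Re_divide)
  also have "y\<^sup>2 / 4 * \<dots> \<le> 0"
    using assms by (intro mult_nonneg_nonpos divide_nonpos_nonneg) auto
  finally show ?thesis
    by (auto simp: skernel_def norm_divide norm_csqrt intro!: divide_right_mono)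
qed

lemma continuous_on_skernel:
  assumes "continuous_on A z" "continuous_on A y" "\<And>a. a \<in> A \<Longrightarrow> z a \<notin> \<real>\<^sub>\<le>\<^sub>0"
  shows "continuous_on A (\<lambda>a. skernel (z a) (y a))"
  unfolding skernel_def using assms
  by (intro continuous_intros continuous_on_compose2[OF continuous_on_csqrt]) force+

lemma not_nonpos_Reals_lower_half:
  assumes "0 \<le> \<tau>" "0 \<le> \<epsilon>" "(\<tau>, \<epsilon>) \<noteq> (0, 0)"
  shows "of_real \<tau> - \<i> * of_real \<epsilon> \<notin> \<real>\<^sub>\<le>\<^sub>0"
  using assms by (auto simp: complex_nonpos_Reals_iff)

lemma norm_lower_half_ge: "\<tau> \<le> norm (of_real \<tau> - \<i> * of_real \<epsilon> :: complex)"
  using complex_Re_le_cmod[of "of_real \<tau> - \<i> * of_real \<epsilon>"] by simp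

lemma integrable_inverse_sqrt:
  assumes "0 \<le> t"
  shows "(\<lambda>s. 1 / sqrt (t - s)) integrable_on {0..t}"
proof -
  have "((\<lambda>s. 1 / sqrt (t - s)) has_integral (- 2 * sqrt (t - t)) - (- 2 * sqrt (t - 0))) {0..t}"
  proof (rule fundamental_theorem_of_calculus_interior)
    show "((\<lambda>s. - 2 * sqrt (t - s)) has_vector_derivative 1 / sqrt (t - s)) (at s)" if "s \<in> {0<..<t}" for s
      unfolding has_real_derivative_iff_has_vector_derivative[symmetric] using that
      by (auto intro!: derivative_eq_intros simp: field_simps)
  qed (use assms in \<open>auto intro!: continuous_intros\<close>)
  then show ?thesis by blast
qed

text \<open>Dominated convergence with the integrable majorant \<open>C / sqrt (t - s)\<close>. The
  point \<open>s = t\<close> is split off as a null set: there the majorant is 0 by division by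
  zero, while \<open>\<phi> \<epsilon> t\<close> may be nonzero.\<close>

lemma weakly_singular_limit:
  fixes \<phi> :: "real \<Rightarrow> real \<Rightarrow> complex"
  assumes t: "0 < t"
    and cont: "continuous_on {(\<epsilon>, s). 0 \<le> \<epsilon> \<and> 0 \<le> s \<and> s \<le> t \<and> (\<epsilon>, s) \<noteq> (0, t)} (\<lambda>(\<epsilon>, s). \<phi> \<epsilon> s)"
    and bound: "\<And>\<epsilon> s. 0 \<le> \<epsilon> \<Longrightarrow> s \<in> {0..<t} \<Longrightarrow> norm (\<phi> \<epsilon> s) \<le> C / sqrt (t - s)"
  shows "\<phi> 0 absolutely_integrable_on {0..t}"
    and "((\<lambda>\<epsilon>. integral {0..t} (\<phi> \<epsilon>)) \<longlongrightarrow> integral {0..t} (\<phi> 0)) (at_right 0)"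
proof -
  let ?D = "{(\<epsilon>, s). 0 \<le> \<epsilon> \<and> 0 \<le> s \<and> s \<le> t \<and> (\<epsilon>, s) \<noteq> (0, t)}"
  let ?g = "\<lambda>s. C * (1 / sqrt (t - s))"
  have slice: "continuous_on A (\<lambda>a. \<phi> (f a) (g a))"
    if "continuous_on A f" "continuous_on A g" "\<And>a. a \<in> A \<Longrightarrow> (f a, g a) \<in> ?D" for A :: "real set" and f g
    using continuous_on_compose2[OF cont continuous_on_Pair[OF that(1,2)]] that(3) by auto
  have g: "?g integrable_on {0..<t}"
  proof -
    have "?g integrable_on {0..t}" using integrable_inverse_sqrt t by (intro integrable_on_mult_right) auto
    then show ?thesis
      by (rule integrable_spike_set) (rule negligible_subset[of "{t}"]; auto)+
  qed
  have abs: "\<phi> \<epsilon> absolutely_integrable_on {0..<t}" if "0 \<le> \<epsilon>" for \<epsilon>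
  proof (rule measurable_bounded_by_integrable_imp_absolutely_integrable[OF _ _ g])
    show "\<phi> \<epsilon> \<in> borel_measurable (lebesgue_on {0..<t})"
      using that by (intro continuous_imp_measurable_on_sets_lebesgue slice continuous_intros) auto
  qed (use bound that in auto)
  have int_eq: "integral {0..t} f = integral {0..<t} f" for f :: "real \<Rightarrow> complex"
    by (rule integral_subset_negligible[symmetric]) (auto intro!: negligible_subset[OF negligible_sing, of _ t])
  show "\<phi> 0 absolutely_integrable_on {0..t}"
    using abs[OF order.refl]
    by (rule absolutely_integrable_spike_set) (rule negligible_subset[of "{t}"]; auto)+
  show "((\<lambda>\<epsilon>. integral {0..t} (\<phi> \<epsilon>)) \<longlongrightarrow> integral {0..t} (\<phi> 0)) (at_right 0)"
  \<comment> \<open>Dominated convergence is a statement about sequences, so the one-sided limit is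
    tested along sequences; the bound 1 is arbitrary.\<close>
  proof (rule tendsto_at_right_sequentially[where b = 1])
    fix S :: "nat \<Rightarrow> real" assume S: "\<And>n. 0 < S n" "S \<longlonglongrightarrow> 0"
    show "(\<lambda>n. integral {0..t} (\<phi> (S n))) \<longlonglongrightarrow> integral {0..t} (\<phi> 0)"
      unfolding int_eq
    proof (rule dominated_convergence[OF _ g])
      show "\<phi> (S n) integrable_on {0..<t}" for n
        using abs[of "S n"] S(1)[of n] by (simp add: absolutely_integrable_on_def)
      show "norm (\<phi> (S n) s) \<le> ?g s" if "s \<in> {0..<t}" for n s
        using bound[of "S n" s] S(1)[of n] that by simp
      fix s assume s: "s \<in> {0..<t}"
      have "continuous_on {0..} (\<lambda>\<epsilon>. \<phi> \<epsilon> s)"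
        using s by (intro slice) auto
      then show "(\<lambda>n. \<phi> (S n) s) \<longlonglongrightarrow> \<phi> 0 s"
        by (rule continuous_on_tendsto_compose) (use S in \<open>auto intro!: always_eventually less_imp_le\<close>)
    qed
  qed simp
qed

text \<open>The substitution \<open>x = m * y\<close> turns the integral into one of
  \<open>exp (- x\<^sup>2)\<close> against \<open>h (x / m)\<close>. The peak sits at an end point,
  so only half of the Gaussian mass \<open>sqrt pi\<close> is seen.\<close>

lemma half_gaussian_limit:
  fixes h :: "real \<Rightarrow> complex"
  assumes h: "continuous_on {0..1} h"
  shows "((\<lambda>m. integral {0..1} (\<lambda>y. (m * exp (- (m * y)\<^sup>2)) *\<^sub>R h y)) \<longlongrightarrow> (sqrt pi / 2) *\<^sub>R h 0) at_top"
proof -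
  define k where "k y = indicator {0..1} y *\<^sub>R h y" for y :: real
  have k [measurable]: "k \<in> borel_measurable borel"
    unfolding k_def by (rule borel_measurable_continuous_on_indicator[OF _ h]) auto
  have "compact (h ` {0..1})" using compact_continuous_image[OF h] by auto
  then have "bounded (h ` {0..1})" by (rule compact_imp_bounded)
  then obtain M where "\<forall>y\<in>{0..1}. norm (h y) \<le> M"
    by (auto simp: bounded_iff)
  then have M: "norm (h y) \<le> M" if "y \<in> {0..1}" for y using that by blast
  have kM: "norm (k y) \<le> M * indicator {0..} y" for y
    using M[of y] order_trans[OF norm_ge_zero M[of 0]] by (auto simp: k_def indicator_def)
  \<comment> \<open>The Gaussian on the half line; times \<open>M\<close> it is the majorant, times
    \<open>h 0\<close> the pointwise limit.\<close>
  let ?E = "\<lambda>x::real. indicator {0..} x *\<^sub>R exp (- x\<^sup>2)"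
  have E: "integrable lborel ?E" "(\<integral>x. ?E x \<partial>lborel) = sqrt pi / 2"
    using gaussian_moment_0 by (auto simp: has_bochner_integral_iff)
  have "((\<lambda>m. \<integral>x. exp (- x\<^sup>2) *\<^sub>R k (x / m) \<partial>lborel) \<longlongrightarrow> (\<integral>x. ?E x *\<^sub>R h 0 \<partial>lborel)) at_top"
  proof (rule integral_dominated_convergence_at_top[where w = "\<lambda>x. ?E x * M"])
    show "integrable lborel (\<lambda>x. ?E x * M)" using E by (intro integrable_mult_left) auto
    show "\<forall>\<^sub>F m in at_top. AE x in lborel. norm (exp (- x\<^sup>2) *\<^sub>R k (x / m)) \<le> ?E x * M"
      using eventually_gt_at_top[of 0]
    proof eventually_elim
      case (elim m)
      have "norm (exp (- x\<^sup>2) *\<^sub>R k (x / m)) \<le> ?E x * M" for x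
        using mult_left_mono[OF kM[of "x / m"], of "exp (- x\<^sup>2)"] elim
        by (auto simp: indicator_def field_simps split: if_splits)
      then show ?case by simp
    qed
    have "((\<lambda>m. exp (- x\<^sup>2) *\<^sub>R k (x / m)) \<longlongrightarrow> ?E x *\<^sub>R h 0) at_top" for x
    proof (cases "0 \<le> x")
      \<comment> \<open>For negative \<open>x\<close> the point \<open>x / m\<close> lies outside
        the support of \<open>k\<close> as soon as \<open>m > 0\<close>.\<close>
      case False
      have "\<forall>\<^sub>F m in at_top. ?E x *\<^sub>R h 0 = exp (- x\<^sup>2) *\<^sub>R k (x / m)"
        using eventually_gt_at_top[of 0]
        by eventually_elim (use False in \<open>auto simp: k_def indicator_def field_simps\<close>)
      then show ?thesis by (rule Lim_transform_eventually[OF tendsto_const])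
    next
      case True
      have lim: "((\<lambda>m. x / m) \<longlongrightarrow> 0) at_top"
        by (intro tendsto_divide_0[OF tendsto_const] filterlim_at_top_imp_at_infinity filterlim_ident)
      have ev: "\<forall>\<^sub>F m in at_top. x / m \<in> {0..1}"
        using eventually_gt_at_top[of "max x 0"]
        by eventually_elim (use True in \<open>auto simp: field_simps\<close>)
      have "((\<lambda>m. h (x / m)) \<longlongrightarrow> h 0) at_top"
        by (rule continuous_on_tendsto_compose[OF h lim _ ev]) auto
      moreover have "\<forall>\<^sub>F m in at_top. h (x / m) = k (x / m)"
        using ev by eventually_elim (auto simp: k_def)
      ultimately have "((\<lambda>m. k (x / m)) \<longlongrightarrow> h 0) at_top" by (rule Lim_transform_eventually)
      then show ?thesis using True by (auto intro!: tendsto_intros)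
    qed
    then show "AE x in lborel. ((\<lambda>m. exp (- x\<^sup>2) *\<^sub>R k (x / m)) \<longlongrightarrow> ?E x *\<^sub>R h 0) at_top" by simp
  qed measurable
  also have "(\<integral>x. ?E x *\<^sub>R h 0 \<partial>lborel) = (sqrt pi / 2) *\<^sub>R h 0"
    using E by (subst integral_scaleR_left) auto
  finally show ?thesis
  proof (rule Lim_transform_eventually)
    show "\<forall>\<^sub>F m in at_top. (\<integral>x. exp (- x\<^sup>2) *\<^sub>R k (x / m) \<partial>lborel)
        = integral {0..1} (\<lambda>y. (m * exp (- (m * y)\<^sup>2)) *\<^sub>R h y)"
      using eventually_gt_at_top[of 0]
    proof eventually_elim
      case (elim m)
      have "continuous_on {0..1} (\<lambda>y. (m * exp (- (m * y)\<^sup>2)) *\<^sub>R h y)"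
        by (intro continuous_intros h)
      then have "integral {0..1} (\<lambda>y. (m * exp (- (m * y)\<^sup>2)) *\<^sub>R h y)
          = (LINT y:{0..1}|lborel. (m * exp (- (m * y)\<^sup>2)) *\<^sub>R h y)"
        by (intro set_borel_integral_eq_integral(2)[symmetric] borel_integrable_atLeastAtMost')
      also have "\<dots> = (\<integral>y. (m * exp (- (m * y)\<^sup>2)) *\<^sub>R k y \<partial>lborel)"
        unfolding set_lebesgue_integral_def k_def by (intro Bochner_Integration.integral_cong) auto
      \<comment> \<open>The affine substitution \<open>y = 0 + 1 / m * x\<close>; its Jacobian
        cancels the factor \<open>m\<close>.\<close>
      also have "\<dots> = \<bar>1 / m\<bar> *\<^sub>R (\<integral>x. (m * exp (- (m * (0 + 1 / m * x))\<^sup>2)) *\<^sub>R k (0 + 1 / m * x) \<partial>lborel)"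
        using elim by (intro lborel_integral_real_affine) auto
      also have "\<dots> = (\<integral>x. exp (- x\<^sup>2) *\<^sub>R k (x / m) \<partial>lborel)"
        using elim by (subst integral_scaleR_right[symmetric]) (auto intro!: Bochner_Integration.integral_cong)
      finally show ?case ..
    qed
  qed
qed

lemma csqrt_minus_ii: "csqrt (- \<i>) = (1 - \<i>) / of_real (sqrt 2)"
proof (rule csqrt_unique)
  have "(complex_of_real (sqrt 2))\<^sup>2 = 2" by (simp flip: of_real_power)
  then show "((1 - \<i>) / of_real (sqrt 2))\<^sup>2 = - \<i>"
    by (simp add: power_divide power2_eq_square algebra_simps)
qed simp

text \<open>At \<open>s = t\<close> one has \<open>z = - \<i> \<epsilon>\<close>, where the
  oscillating exponential becomes the real Gaussian
  \<open>exp (- (w y)\<^sup>2 / (4 \<epsilon>))\<close>. This is \<open>half_gaussian_limit\<close>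
  with \<open>m = w / (2 sqrt \<epsilon>)\<close>.\<close>

lemma half_delta_limit:
  fixes h :: "real \<Rightarrow> complex"
  assumes h: "continuous_on {0..1} h" and w: "0 < w"
  shows "((\<lambda>\<epsilon>. integral {0..1} (\<lambda>y. w *\<^sub>R (h y * skernel (- (\<i> * of_real \<epsilon>)) (of_real (w * y)))))
    \<longlongrightarrow> of_real (sqrt pi) / csqrt (- \<i>) * h 0) (at_right 0)"
proof -
  have f: "filterlim (\<lambda>\<epsilon>. w / (2 * sqrt \<epsilon>)) at_top (at_right 0)"
  proof -
    have "filterlim sqrt (at_right 0) (at_right 0)"
      by (rule filterlim_at_withinI) (auto intro!: tendsto_eq_intros eventually_at_rightI[of 0 1])
    then have "filterlim (\<lambda>\<epsilon>. w / 2 * inverse (sqrt \<epsilon>)) at_top (at_right 0)"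
      using w by (intro filterlim_tendsto_pos_mult_at_top[OF tendsto_const]
          filterlim_compose[OF filterlim_inverse_at_top_right]) auto
    then show ?thesis by (simp add: field_simps)
  qed
  have "((\<lambda>\<epsilon>. 2 / csqrt (- \<i>) * integral {0..1} (\<lambda>y. (w / (2 * sqrt \<epsilon>) * exp (- (w / (2 * sqrt \<epsilon>) * y)\<^sup>2)) *\<^sub>R h y))
      \<longlongrightarrow> 2 / csqrt (- \<i>) * ((sqrt pi / 2) *\<^sub>R h 0)) (at_right 0)"
    by (intro tendsto_mult_left filterlim_compose[OF half_gaussian_limit[OF h] f])
  also have "2 / csqrt (- \<i>) * ((sqrt pi / 2) *\<^sub>R h 0) = of_real (sqrt pi) / csqrt (- \<i>) * h 0"
    by (simp add: scaleR_conv_of_real)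
  finally show ?thesis
  proof (rule Lim_transform_eventually)
    show "\<forall>\<^sub>F \<epsilon> in at_right 0.
        2 / csqrt (- \<i>) * integral {0..1} (\<lambda>y. (w / (2 * sqrt \<epsilon>) * exp (- (w / (2 * sqrt \<epsilon>) * y)\<^sup>2)) *\<^sub>R h y)
      = integral {0..1} (\<lambda>y. w *\<^sub>R (h y * skernel (- (\<i> * of_real \<epsilon>)) (of_real (w * y))))"
    proof (rule eventually_at_rightI[of 0 1])
      fix \<epsilon> :: real assume "\<epsilon> \<in> {0<..<1}"
      then have e: "0 < \<epsilon>" by simp
      \<comment> \<open>A positive real factor does not leave the principal branch, so
        \<open>csqrt\<close> splits.\<close>
      have c: "csqrt (- (\<i> * of_real \<epsilon>)) = of_real (sqrt \<epsilon>) * csqrt (- \<i>)"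
      proof (rule csqrt_unique)
        have "(complex_of_real (sqrt \<epsilon>))\<^sup>2 = of_real \<epsilon>" using e by (simp flip: of_real_power)
        then show "(of_real (sqrt \<epsilon>) * csqrt (- \<i>))\<^sup>2 = - (\<i> * of_real \<epsilon>)"
          by (simp add: power_mult_distrib)
        show "0 < Re (of_real (sqrt \<epsilon>) * csqrt (- \<i>)) \<or>
            Re (of_real (sqrt \<epsilon>) * csqrt (- \<i>)) = 0 \<and> 0 \<le> Im (of_real (sqrt \<epsilon>) * csqrt (- \<i>))"
          using e unfolding csqrt_minus_ii by simp
      qed
      have "w *\<^sub>R (h y * skernel (- (\<i> * of_real \<epsilon>)) (of_real (w * y)))
          = 2 / csqrt (- \<i>) * ((w / (2 * sqrt \<epsilon>) * exp (- (w / (2 * sqrt \<epsilon>) * y)\<^sup>2)) *\<^sub>R h y)" for y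
      proof -
        have "\<i> * (complex_of_real (w * y))\<^sup>2 / (4 * - (\<i> * of_real \<epsilon>)) = of_real (- (w / (2 * sqrt \<epsilon>) * y)\<^sup>2)"
          using e by (simp add: power_mult_distrib power_divide field_simps flip: of_real_power)
        then have "exp (\<i> * (complex_of_real (w * y))\<^sup>2 / (4 * - (\<i> * of_real \<epsilon>)))
            = of_real (exp (- (w / (2 * sqrt \<epsilon>) * y)\<^sup>2))" by (simp only: exp_of_real)
        then show ?thesis unfolding skernel_def c by (simp add: scaleR_conv_of_real field_simps)
      qed
      then show "2 / csqrt (- \<i>) * integral {0..1} (\<lambda>y. (w / (2 * sqrt \<epsilon>) * exp (- (w / (2 * sqrt \<epsilon>) * y)\<^sup>2)) *\<^sub>R h y)
          = integral {0..1} (\<lambda>y. w *\<^sub>R (h y * skernel (- (\<i> * of_real \<epsilon>)) (of_real (w * y))))"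
        by (simp only: integral_mult_right)
    qed simp
  qed
qed

text \<open>The source of the factor \<open>pi\<close> in front of the Neumann values.\<close>

lemma half_delta_constant:
  "(1 - \<i>) * of_real (sqrt (2 * pi)) / 2 * (of_real (sqrt pi) / csqrt (- \<i>)) = of_real pi"
proof -
  have [simp]: "(1 - \<i>) \<noteq> 0" by (simp add: complex_eq_iff)
  have "complex_of_real (sqrt 2) * of_real (sqrt 2) = 2" "complex_of_real (sqrt pi) * of_real (sqrt pi) = of_real pi"
    by (simp_all flip: of_real_mult)
  then show ?thesis unfolding csqrt_minus_ii real_sqrt_mult of_real_mult
    by (simp add: field_simps)
qed

section \<open>The kernels of the integral equations and their limits\<close>

lemma skernel_minus: "skernel z (- y) = skernel z y"
  by (simp add: skernel_def)

lemma K_off_skernel: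
  "K_off lj lm t s \<epsilon> = (1 - \<i>) * of_real (sqrt (2 * pi)) / 4
     * (of_real (lj t - lm s) / (of_real (t - s) - \<i> * of_real \<epsilon>))
     * skernel (of_real (t - s) - \<i> * of_real \<epsilon>) (of_real (lj t - lm s))"
  by (simp add: K_off_def skernel_def Let_def)

lemma skernel_of_real:
  assumes "0 \<le> \<tau>"
  shows "skernel (of_real \<tau>) (of_real y) = exp (\<i> * of_real (y\<^sup>2 / (4 * \<tau>))) / of_real (sqrt \<tau>)"
  using assms by (simp add: skernel_def)

text \<open>At \<open>s = t\<close> both sides are \<open>0\<close>, since they divide by \<open>0\<close>.\<close>

lemma K_diag_eq_K_off: "s \<le> t \<Longrightarrow> K_diag l t s = K_off l l t s 0"
  using skernel_of_real[of "t - s" "l t - l s"] by (simp add: K_off_skernel K_diag_def)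

text \<open>For positive \<epsilon> the imaginary part of \<open>z\<close> is
  \<open>- \<epsilon>\<close>, so \<open>z\<close> stays off the branch cut for every real
  \<open>s\<close>. The derivative of \<open>z\<close> in \<open>s\<close> is -1, which yields the
  sign of the adjoint equation.\<close>

lemma backward_kernel_skernel:
  assumes "0 < \<epsilon>"
  shows "backward_kernel
    (\<lambda>x s. skernel (of_real (t - s) - \<i> * of_real \<epsilon>) (of_real (x - x0)))
    (\<lambda>x s. skernel_y (of_real (t - s) - \<i> * of_real \<epsilon>) (of_real (x - x0)))
    (\<lambda>x s. skernel_yy (of_real (t - s) - \<i> * of_real \<epsilon>) (of_real (x - x0)))
    (\<lambda>x s. skernel_yyy (of_real (t - s) - \<i> * of_real \<epsilon>) (of_real (x - x0)))"
proof -
  define z where "z s = complex_of_real (t - s) - \<i> * of_real \<epsilon>" for s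
  have z: "z s \<notin> \<real>\<^sub>\<le>\<^sub>0" "z s \<noteq> 0" for s
    using assms by (auto simp: z_def complex_nonpos_Reals_iff complex_eq_iff)
  have dx: "((\<lambda>x. complex_of_real (x - x0)) has_vector_derivative 1) (at x)" for x
    by (auto intro!: derivative_eq_intros)
  have ds: "(z has_vector_derivative - 1) (at s)" for s
    unfolding z_def by (auto intro!: derivative_eq_intros)
  have cz: "continuous_on A (\<lambda>p. z (snd p))" for A :: "(real \<times> real) set"
    unfolding z_def by (intro continuous_intros)
  have c: "continuous_on A (\<lambda>p. skernel (z (snd p)) (of_real (fst p - x0)))" for A
    by (intro continuous_on_skernel cz continuous_intros z)
  show ?thesis unfolding z_def[symmetric]
  proof
    fix x s
    show "((\<lambda>x. skernel (z s) (of_real (x - x0))) has_vector_derivative skernel_y (z s) (of_real (x - x0))) (at x)"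
      "((\<lambda>x. skernel_y (z s) (of_real (x - x0))) has_vector_derivative skernel_yy (z s) (of_real (x - x0))) (at x)"
      "((\<lambda>x. skernel_yy (z s) (of_real (x - x0))) has_vector_derivative skernel_yyy (z s) (of_real (x - x0))) (at x)"
      using field_vector_diff_chain_at[OF dx skernel_deriv_y(1)[OF z(2)]]
        field_vector_diff_chain_at[OF dx skernel_deriv_y(2)[OF z(2)]]
        field_vector_diff_chain_at[OF dx skernel_deriv_y(3)[OF z(2)]]
      by (simp_all add: o_def)
    show "((\<lambda>s. skernel (z s) (of_real (x - x0))) has_vector_derivative - \<i> * skernel_yy (z s) (of_real (x - x0))) (at s)"
      "((\<lambda>s. skernel_y (z s) (of_real (x - x0))) has_vector_derivative - \<i> * skernel_yyy (z s) (of_real (x - x0))) (at s)"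
      using field_vector_diff_chain_at[OF ds skernel_deriv_z(1)[OF z(1)]]
        field_vector_diff_chain_at[OF ds skernel_deriv_z(2)[OF z(1)]]
      by (simp_all add: o_def)
  next
    show "continuous_on UNIV (\<lambda>(x, s). skernel (z s) (of_real (x - x0)))"
      using c by (simp add: case_prod_unfold)
    show "continuous_on UNIV (\<lambda>(x, s). skernel_y (z s) (of_real (x - x0)))"
      "continuous_on UNIV (\<lambda>(x, s). skernel_yy (z s) (of_real (x - x0)))"
      "continuous_on UNIV (\<lambda>(x, s). skernel_yyy (z s) (of_real (x - x0)))"
      unfolding case_prod_unfold skernel_y_def skernel_yy_def skernel_yyy_def
      by (intro continuous_intros c cz; use z in simp)+
  qed
qed

text \<open>The mean value inequality with the bound of \<open>l'\<close> on the compact interval.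
  It compensates the factor \<open>1 / (t - s)\<close> of the diagonal kernel.\<close>

lemma C1_Lipschitz:
  fixes l l' :: "real \<Rightarrow> real"
  assumes l: "\<And>s. s \<in> {0..T} \<Longrightarrow> (l has_vector_derivative l' s) (at s within {0..T})"
    and l'_cont: "continuous_on {0..T} l'"
  shows "\<exists>B\<ge>0. \<forall>s\<in>{0..T}. \<forall>t\<in>{0..T}. \<bar>l t - l s\<bar> \<le> B * \<bar>t - s\<bar>"
proof -
  have "bounded (l' ` {0..T})"
    using compact_continuous_image[OF l'_cont] by (auto intro: compact_imp_bounded)
  then obtain B where B: "0 < B" "\<forall>s\<in>{0..T}. \<bar>l' s\<bar> \<le> B"
    by (auto simp: bounded_pos)
  have "norm (l t - l s) \<le> B * norm (t - s)" if "s \<in> {0..T}" "t \<in> {0..T}" for s t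
  proof (rule differentiable_bound[where S = "{0..T}" and f' = "\<lambda>s h. h *\<^sub>R l' s"])
    show "onorm (\<lambda>h. h *\<^sub>R l' s) \<le> B" if "s \<in> {0..T}" for s
    proof (rule onorm_bound)
      show "norm (h *\<^sub>R l' s) \<le> B * norm h" for h
        using mult_left_mono[of "\<bar>l' s\<bar>" B "\<bar>h\<bar>"] B(2) that by (simp add: abs_mult mult.commute)
    qed (use B in simp)
  qed (use l that in \<open>auto simp: has_vector_derivative_def\<close>)
  then show ?thesis using B by (intro exI[of _ B]) auto
qed

text \<open>The Lipschitz bound and \<open>t - s \<le> norm z\<close> make the quotient
  \<open>(l t - l s) / z\<close> bounded uniformly in \<epsilon>. Only the weak singularity of
  \<open>skernel\<close> is left, and \<open>weakly_singular_limit\<close> applies.\<close>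

lemma K_diag_limit:
  fixes v :: "real \<Rightarrow> complex"
  assumes t: "t \<in> {0<..T}"
    and l: "\<And>s. s \<in> {0..T} \<Longrightarrow> (l has_vector_derivative l' s) (at s within {0..T})"
    and l'_cont: "continuous_on {0..T} l'" and v: "continuous_on {0..T} v"
  shows "(\<lambda>s. K_diag l t s * v s) absolutely_integrable_on {0..t}"
    and "((\<lambda>\<epsilon>. integral {0..t} (\<lambda>s. K_off l l t s \<epsilon> * v s)) \<longlongrightarrow>
      integral {0..t} (\<lambda>s. K_diag l t s * v s)) (at_right 0)"
proof -
  obtain B where B: "0 \<le> B" "\<And>s t. s \<in> {0..T} \<Longrightarrow> t \<in> {0..T} \<Longrightarrow> \<bar>l t - l s\<bar> \<le> B * \<bar>t - s\<bar>"
    using C1_Lipschitz[OF l l'_cont] by blast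
  have l_cont: "continuous_on {0..T} l"
    using has_vector_derivative_continuous[OF l] by (auto simp: continuous_on_eq_continuous_within)
  have "bounded (v ` {0..T})"
    using compact_continuous_image[OF v] by (auto intro: compact_imp_bounded)
  then obtain M where M: "0 < M" "\<forall>s\<in>{0..T}. norm (v s) \<le> M"
    by (auto simp: bounded_pos)
  let ?c = "(1 - \<i>) * of_real (sqrt (2 * pi)) / 4"
  let ?D = "{(\<epsilon>, s). 0 \<le> \<epsilon> \<and> 0 \<le> s \<and> s \<le> t \<and> (\<epsilon>, s) \<noteq> (0, t)}"
  have z: "complex_of_real (t - snd p) - \<i> * of_real (fst p) \<notin> \<real>\<^sub>\<le>\<^sub>0" if "p \<in> ?D" for p
    using that by (intro not_nonpos_Reals_lower_half) (auto simp: case_prod_unfold prod_eq_iff)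
  have z0: "complex_of_real (t - snd p) - \<i> * of_real (fst p) \<noteq> 0" if "p \<in> ?D" for p
    using z[OF that] by (metis nonpos_Reals_zero_I)
  have cont: "continuous_on ?D (\<lambda>(\<epsilon>, s). K_off l l t s \<epsilon> * v s)"
    unfolding K_off_skernel case_prod_unfold using t z0
    by (intro continuous_intros continuous_on_skernel z continuous_on_compose2[OF l_cont] continuous_on_compose2[OF v])
      (auto simp: case_prod_unfold)
  have bound: "norm (K_off l l t s \<epsilon> * v s) \<le> (norm ?c * B * M) / sqrt (t - s)"
    if "0 \<le> \<epsilon>" "s \<in> {0..<t}" for \<epsilon> s
  proof -
    let ?z = "complex_of_real (t - s) - \<i> * of_real \<epsilon>"
    have z: "t - s \<le> norm ?z" by (rule norm_lower_half_ge)
    have ts: "0 < t - s" using that by simp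
    have "norm (complex_of_real (l t - l s) / ?z) \<le> B * (t - s) / (t - s)"
      using B(2)[of s t] that t z ts unfolding norm_divide norm_of_real by (intro frac_le) auto
    then have 1: "norm (complex_of_real (l t - l s) / ?z) \<le> B" using ts by simp
    have "norm (skernel ?z (of_real (l t - l s))) \<le> 1 / sqrt (norm ?z)"
      using that by (intro norm_skernel_le) simp
    also have "\<dots> \<le> 1 / sqrt (t - s)" using z ts by (intro divide_left_mono) auto
    finally have 2: "norm (skernel ?z (of_real (l t - l s))) \<le> 1 / sqrt (t - s)" .
    have "norm (K_off l l t s \<epsilon> * v s) = norm ?c * norm (complex_of_real (l t - l s) / ?z)
        * norm (skernel ?z (of_real (l t - l s))) * norm (v s)"
      unfolding K_off_skernel norm_mult ..
    also have "\<dots> \<le> norm ?c * B * (1 / sqrt (t - s)) * M"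
      using 1 2 M that t B(1) ts by (intro mult_mono mult_nonneg_nonneg) auto
    finally show ?thesis by simp
  qed
  have eq: "K_off l l t s 0 * v s = K_diag l t s * v s" if "s \<in> {0..t}" for s
    using that by (simp add: K_diag_eq_K_off)
  have "0 < t" using t by simp
  note lim = weakly_singular_limit[OF this cont bound]
  show "(\<lambda>s. K_diag l t s * v s) absolutely_integrable_on {0..t}"
    using absolutely_integrable_spike[OF lim(1), of "{}"] eq by auto
  have "integral {0..t} (\<lambda>s. K_off l l t s 0 * v s) = integral {0..t} (\<lambda>s. K_diag l t s * v s)"
    by (rule integral_cong) (rule eq)
  then show "((\<lambda>\<epsilon>. integral {0..t} (\<lambda>s. K_off l l t s \<epsilon> * v s)) \<longlongrightarrow>
      integral {0..t} (\<lambda>s. K_diag l t s * v s)) (at_right 0)"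
    using lim(2) by simp
qed

text \<open>Here the bound of \<open>skernel\<close> alone gives the majorant, whether or not
  \<open>x0\<close> lies on the curve \<open>l\<close> at time \<open>t\<close>.\<close>

lemma single_layer_limit:
  fixes v :: "real \<Rightarrow> complex" and l :: "real \<Rightarrow> real" and x0 :: real
  assumes t: "0 < t" and l: "continuous_on {0..t} l" and v: "continuous_on {0..t} v"
  defines "\<phi> \<equiv> \<lambda>\<epsilon> s. skernel (of_real (t - s) - \<i> * of_real \<epsilon>) (of_real (x0 - l s)) * v s"
  shows "\<phi> 0 absolutely_integrable_on {0..t}"
    and "((\<lambda>\<epsilon>. integral {0..t} (\<phi> \<epsilon>)) \<longlongrightarrow> integral {0..t} (\<phi> 0)) (at_right 0)"
proof -
  have "bounded (v ` {0..t})"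
    using compact_continuous_image[OF v] by (auto intro: compact_imp_bounded)
  then obtain M where M: "0 < M" "\<forall>s\<in>{0..t}. norm (v s) \<le> M"
    by (auto simp: bounded_pos)
  let ?D = "{(\<epsilon>, s). 0 \<le> \<epsilon> \<and> 0 \<le> s \<and> s \<le> t \<and> (\<epsilon>, s) \<noteq> (0, t)}"
  have z: "complex_of_real (t - snd p) - \<i> * of_real (fst p) \<notin> \<real>\<^sub>\<le>\<^sub>0" if "p \<in> ?D" for p
    using that by (intro not_nonpos_Reals_lower_half) (auto simp: case_prod_unfold prod_eq_iff)
  have cont: "continuous_on ?D (\<lambda>(\<epsilon>, s). \<phi> \<epsilon> s)"
    unfolding \<phi>_def case_prod_unfold
    by (intro continuous_intros continuous_on_skernel z continuous_on_compose2[OF l] continuous_on_compose2[OF v])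
      (auto simp: case_prod_unfold)
  have bound: "norm (\<phi> \<epsilon> s) \<le> M / sqrt (t - s)" if "0 \<le> \<epsilon>" "s \<in> {0..<t}" for \<epsilon> s
  proof -
    let ?z = "complex_of_real (t - s) - \<i> * of_real \<epsilon>"
    have "norm (skernel ?z (of_real (x0 - l s))) \<le> 1 / sqrt (norm ?z)"
      using that by (intro norm_skernel_le) simp
    also have "\<dots> \<le> 1 / sqrt (t - s)"
      using norm_lower_half_ge[of "t - s" \<epsilon>] that by (intro divide_left_mono) auto
    finally have "norm (\<phi> \<epsilon> s) \<le> 1 / sqrt (t - s) * M"
      unfolding \<phi>_def norm_mult using M that by (intro mult_mono) auto
    then show ?thesis by simp
  qed
  show "\<phi> 0 absolutely_integrable_on {0..t}"
    "((\<lambda>\<epsilon>. integral {0..t} (\<phi> \<epsilon>)) \<longlongrightarrow> integral {0..t} (\<phi> 0)) (at_right 0)"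
    using weakly_singular_limit[OF t cont bound] by auto
qed

text \<open>At \<open>s = 0\<close> the argument \<open>t - \<i> \<epsilon>\<close> stays away from
  0, so the integrand is jointly continuous up to \<epsilon> = 0.\<close>

lemma initial_layer_limit:
  assumes t: "0 < t" and v: "continuous_on {a..b} v"
  shows "((\<lambda>\<epsilon>. integral {a..b} (\<lambda>x. v x * skernel (of_real t - \<i> * of_real \<epsilon>) (of_real (x - x0)))) \<longlongrightarrow>
    integral {a..b} (\<lambda>x. v x * skernel (of_real t) (of_real (x - x0)))) (at_right 0)"
proof -
  have z: "complex_of_real t - \<i> * of_real \<epsilon> \<notin> \<real>\<^sub>\<le>\<^sub>0" if "0 \<le> \<epsilon>" for \<epsilon>
    using t that by (intro not_nonpos_Reals_lower_half) auto
  have "continuous_on {0..} (\<lambda>\<epsilon>. integral (cbox a b) (\<lambda>x. v x * skernel (of_real t - \<i> * of_real \<epsilon>) (of_real (x - x0))))"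
    using z by (intro integral_continuous_on_param) (auto simp: case_prod_unfold intro!: continuous_intros
        continuous_on_skernel continuous_on_compose2[OF v])
  then have "((\<lambda>\<epsilon>. integral {a..b} (\<lambda>x. v x * skernel (of_real t - \<i> * of_real \<epsilon>) (of_real (x - x0)))) \<longlongrightarrow>
    integral {a..b} (\<lambda>x. v x * skernel (of_real t - \<i> * of_real 0) (of_real (x - x0)))) (at 0 within {0..})"
    unfolding continuous_on_def box_real by (rule bspec) simp
  then have "((\<lambda>\<epsilon>. integral {a..b} (\<lambda>x. v x * skernel (of_real t - \<i> * of_real \<epsilon>) (of_real (x - x0)))) \<longlongrightarrow>
    integral {a..b} (\<lambda>x. v x * skernel (of_real t - \<i> * of_real 0) (of_real (x - x0)))) (at_right 0)"
    by (rule tendsto_mono[OF at_le, rotated]) auto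
  then show ?thesis by simp
qed

section \<open>The integral equations\<close>

lemma integral_reflect_unit:
  fixes f :: "real \<Rightarrow> 'a::banach"
  shows "integral {0..1} (\<lambda>y. f (1 - y)) = integral {0..1} f"
  using Henstock_Kurzweil_Integration.integral_reflect_real[of 0 "-1" "\<lambda>y. f (y + 1)"]
    integral_shift_real_ivl[where a = 0 and b = 1 and c = 1 and f = f] by (simp add: add.commute)

section \<open>The Dirichlet problem: regularised equations and their limits\<close>

locale dirichlet_problem = moving_domain +
  fixes L :: real and q0 q0' f0 f0' f1 g0 g0' g1 :: "real \<Rightarrow> complex"
  assumes l1_0: "l1 0 = 0" and l2_0: "l2 0 = L"
    and q0: "\<And>x. x \<in> {0..L} \<Longrightarrow> (q0 has_vector_derivative q0' x) (at x within {0..L})"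
    and q0'_cont: "continuous_on {0..L} q0'"
    and q0_eq: "\<And>x. x \<in> {0<..<L} \<Longrightarrow> q x 0 = q0 x"
    and f0: "\<And>s. s \<in> {0..T} \<Longrightarrow> (f0 has_vector_derivative f0' s) (at s within {0..T})"
    and f0'_cont: "continuous_on {0..T} f0'" and f1_cont: "continuous_on {0..T} f1"
    and g0: "\<And>s. s \<in> {0..T} \<Longrightarrow> (g0 has_vector_derivative g0' s) (at s within {0..T})"
    and g0'_cont: "continuous_on {0..T} g0'" and g1_cont: "continuous_on {0..T} g1"
    and f_eq: "\<And>s. s \<in> {0<..<T} \<Longrightarrow> q (l1 s) s = f0 s" "\<And>s. s \<in> {0<..<T} \<Longrightarrow> qx (l1 s) s = f1 s"
    and g_eq: "\<And>s. s \<in> {0<..<T} \<Longrightarrow> q (l2 s) s = g0 s" "\<And>s. s \<in> {0<..<T} \<Longrightarrow> qx (l2 s) s = g1 s"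
begin

text \<open>The left-hand side of \<open>global_relation\<close> for this kernel centred at
  \<open>lj t\<close>; \<open>t - t\<close> is kept so that it is literally the instance
  \<open>s = t\<close>.\<close>

definition slice :: "(real \<Rightarrow> real) \<Rightarrow> real \<Rightarrow> real \<Rightarrow> complex" where
  "slice lj t \<epsilon> = integral {0..1} (\<lambda>y. (l2 t - l1 t) *\<^sub>R
     (qx (X y t) t * skernel (of_real (t - t) - \<i> * of_real \<epsilon>) (of_real (X y t - lj t))))"

text \<open>The part of the regularised relation that involves only given data; with the prefactor
  it tends to \<open>N_data\<close>.\<close>

definition data_term :: "(real \<Rightarrow> real) \<Rightarrow> real \<Rightarrow> real \<Rightarrow> complex" where
  "data_term lj t \<epsilon> = integral {0..L} (\<lambda>x. q0' x * skernel (of_real t - \<i> * of_real \<epsilon>) (of_real (x - lj t)))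
    - integral {0..t} (\<lambda>s. skernel (of_real (t - s) - \<i> * of_real \<epsilon>) (of_real (lj t - l1 s)) * f0' s)
    + integral {0..t} (\<lambda>s. skernel (of_real (t - s) - \<i> * of_real \<epsilon>) (of_real (lj t - l2 s)) * g0' s)"

text \<open>The global relation multiplied by the prefactor of the equations. It treats both
  boundaries at once: the choice of \<open>lj\<close> decides which of the two Neumann integrals is
  the diagonal one.\<close>

lemma regularised_identity:
  assumes t: "t \<in> {0<..<T}" and \<epsilon>: "0 < \<epsilon>"
  shows "(1 - \<i>) * of_real (sqrt (2 * pi)) / 2 * slice lj t \<epsilon>
    = (1 - \<i>) * of_real (sqrt (2 * pi)) / 2 * data_term lj t \<epsilon>
      + integral {0..t} (\<lambda>s. K_off lj l1 t s \<epsilon> * f1 s) - integral {0..t} (\<lambda>s. K_off lj l2 t s \<epsilon> * g1 s)"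
proof -
  let ?z = "\<lambda>s. complex_of_real (t - s) - \<i> * of_real \<epsilon>"
  interpret green T l1 l2 l1' l2' q qx qt qxx
    "\<lambda>x s. skernel (?z s) (of_real (x - lj t))" "\<lambda>x s. skernel_y (?z s) (of_real (x - lj t))"
    "\<lambda>x s. skernel_yy (?z s) (of_real (x - lj t))" "\<lambda>x s. skernel_yyy (?z s) (of_real (x - lj t))"
    by (intro green.intro moving_domain_axioms backward_kernel_skernel \<epsilon>)
  let ?c = "(1 - \<i>) * of_real (sqrt (2 * pi)) / 2"
  have sub: "{0..t} \<subseteq> {0..T}" using t by auto
  have z: "?z s \<notin> \<real>\<^sub>\<le>\<^sub>0" "?z s \<noteq> 0" for s
    using \<epsilon> by (auto simp: complex_nonpos_Reals_iff complex_eq_iff)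
  note cs = continuous_on_subset[OF f0'_cont sub] continuous_on_subset[OF f1_cont sub]
    continuous_on_subset[OF g0'_cont sub] continuous_on_subset[OF g1_cont sub]
    continuous_on_subset[OF l_cont(1) sub] continuous_on_subset[OF l_cont(2) sub]
  \<comment> \<open>The kernel is even in its second argument, and the prefactor times
    \<open>- \<i> * skernel_y\<close> is \<open>K_off\<close> up to the sign from reversing
    \<open>l s - lj t\<close>.\<close>
  have layer: "?c * integral {0..t} (\<lambda>s. u s * skernel (?z s) (of_real (l s - lj t)) - \<i> * (skernel_y (?z s) (of_real (l s - lj t)) * v s))
      = ?c * integral {0..t} (\<lambda>s. skernel (?z s) (of_real (lj t - l s)) * u s) - integral {0..t} (\<lambda>s. K_off lj l t s \<epsilon> * v s)"
    if [continuous_intros]: "continuous_on {0..t} l" "continuous_on {0..t} u" "continuous_on {0..t} v" for l u v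
  proof -
    have sym: "skernel (?z s) (of_real (l s - lj t)) = skernel (?z s) (of_real (lj t - l s))" for s
      using skernel_minus[of "?z s" "of_real (lj t - l s)"] by (simp only: of_real_minus[symmetric] minus_diff_eq)
    have eq: "?c * (u s * skernel (?z s) (of_real (l s - lj t)) - \<i> * (skernel_y (?z s) (of_real (l s - lj t)) * v s))
        = ?c * (skernel (?z s) (of_real (lj t - l s)) * u s) - K_off lj l t s \<epsilon> * v s" for s
    proof -
      have alg: "c * (a * S - \<i> * (\<i> * (- d) / (2 * z) * S * b)) = c * (S * a) - c / 2 * (d / z) * S * b"
        if "z \<noteq> 0" for a b c d S z :: complex
        using that by (simp add: field_simps)
      have skernel_y: "skernel_y (?z s) (of_real (l s - lj t))
          = \<i> * (- of_real (lj t - l s)) / (2 * ?z s) * skernel (?z s) (of_real (lj t - l s))"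
        unfolding skernel_y_def sym by simp
      have "K_off lj l t s \<epsilon> = ?c / 2 * (of_real (lj t - l s) / ?z s) * skernel (?z s) (of_real (lj t - l s))"
        unfolding K_off_skernel by simp
      then show ?thesis unfolding sym skernel_y by (simp only: alg[OF z(2)])
    qed
    have "(\<lambda>s. ?c * (skernel (?z s) (of_real (lj t - l s)) * u s)) integrable_on {0..t}"
      "(\<lambda>s. K_off lj l t s \<epsilon> * v s) integrable_on {0..t}"
      unfolding K_off_skernel
      by (intro integrable_continuous_interval continuous_intros continuous_on_skernel z ballI)+
    then show ?thesis
      unfolding integral_mult_right[symmetric] eq by (rule Henstock_Kurzweil_Integration.integral_diff)
  qed
  have "slice lj t \<epsilon> = integral {l1 0..l2 0} (\<lambda>x. q0' x * skernel (?z 0) (of_real (x - lj t)))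
      + integral {0..t} (\<lambda>s. g0' s * skernel (?z s) (of_real (l2 s - lj t)) - \<i> * (skernel_y (?z s) (of_real (l2 s - lj t)) * g1 s))
      - integral {0..t} (\<lambda>s. f0' s * skernel (?z s) (of_real (l1 s - lj t)) - \<i> * (skernel_y (?z s) (of_real (l1 s - lj t)) * f1 s))"
    unfolding slice_def
    by (intro global_relation[OF t _ _ _ f0 f0'_cont f1_cont g0 g0'_cont g1_cont f_eq g_eq])
      (auto simp: l1_0 l2_0 q0 q0'_cont q0_eq)
  note slice = this[unfolded l1_0 l2_0 diff_zero]
  \<comment> \<open>Abstract letters stand for the integrals, so the simplifier cannot rewrite
    inside them.\<close>
  have alg: "c * S = c * (Q - I1 + I2) + k1 - k2"
    if "S = Q + A2 - A1" "c * A1 = c * I1 - k1" "c * A2 = c * I2 - k2" for c S Q A1 A2 I1 I2 k1 k2 :: complex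
    unfolding that(1) distrib_left right_diff_distrib that(2,3) by simp
  show ?thesis
    unfolding data_term_def by (rule alg[OF slice layer[OF cs(5,1,2)] layer[OF cs(6,3,4)]])
qed

text \<open>Since \<open>X y t - l1 t\<close> is \<open>y\<close> times the width of the slice,
  \<open>half_delta_limit\<close> applies directly, with the peak at \<open>y = 0\<close>.\<close>

lemma slice_limit_l1:
  assumes t: "t \<in> {0<..<T}"
  shows "(slice l1 t \<longlongrightarrow> of_real (sqrt pi) / csqrt (- \<i>) * f1 t) (at_right 0)"
proof -
  have "continuous_on {0..1} (\<lambda>y. qx (X y t) t)"
    by (intro qx_cont' X_cont'(1) continuous_intros X_lateral) (use t in auto)
  from half_delta_limit[OF this, of "l2 t - l1 t"] show ?thesis
    using t l_less f_eq(2) by (simp add: slice_def[abs_def] X_def mult.commute)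
qed

text \<open>Now the peak is at \<open>y = 1\<close>; the reflection of the unit interval and the
  evenness of the kernel bring it to 0.\<close>

lemma slice_limit_l2:
  assumes t: "t \<in> {0<..<T}"
  shows "(slice l2 t \<longlongrightarrow> of_real (sqrt pi) / csqrt (- \<i>) * g1 t) (at_right 0)"
proof -
  have cont: "continuous_on {0..1} (\<lambda>y. qx (X (1 - y) t) t)"
    by (intro qx_cont' X_cont'(1) continuous_intros X_lateral) (use t in auto)
  let ?w = "l2 t - l1 t"
  have eq: "slice l2 t = (\<lambda>\<epsilon>. integral {0..1} (\<lambda>y. ?w *\<^sub>R (qx (X (1 - y) t) t * skernel (- (\<i> * of_real \<epsilon>)) (of_real (?w * y)))))"
  proof
    fix \<epsilon>
    let ?F = "\<lambda>y. ?w *\<^sub>R (qx (X (1 - y) t) t * skernel (- (\<i> * of_real \<epsilon>)) (of_real (?w * y)))"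
    have "integral {0..1} ?F = integral {0..1} (\<lambda>y. ?F (1 - y))"
      by (rule integral_reflect_unit[symmetric])
    also have "\<dots> = slice l2 t \<epsilon>"
    proof -
      have "skernel z (of_real (?w * (1 - y))) = skernel z (of_real (X y t - l2 t))" for z y
      proof -
        have "complex_of_real (X y t - l2 t) = - of_real (?w * (1 - y))" by (simp add: X_def algebra_simps)
        then show ?thesis by (simp only: skernel_minus)
      qed
      then show ?thesis by (simp add: slice_def)
    qed
    finally show "slice l2 t \<epsilon> = integral {0..1} ?F" ..
  qed
  show ?thesis
    unfolding eq using half_delta_limit[OF cont, of ?w] t l_less g_eq(2) by simp
qed

text \<open>The value \<open>s = t\<close> is included, because both sides are then 0 by division by
  zero.\<close>

lemma dirichlet_integrand_eq:
  assumes "s \<in> {0..t}" "t < T"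
  shows "dirichlet_integrand T l1 l2 f0 g0 lj t s
    = skernel (of_real (t - s) - \<i> * of_real 0) (of_real (lj t - l1 s)) * f0' s
      - skernel (of_real (t - s) - \<i> * of_real 0) (of_real (lj t - l2 s)) * g0' s"
proof -
  have s: "s \<in> {0..T}" "0 \<le> t - s" using assms by auto
  have "vector_derivative f0 (at s within {0..T}) = f0' s" "vector_derivative g0 (at s within {0..T}) = g0' s"
    using vector_derivative_within_closed_interval[OF T_pos s(1)] f0[OF s(1)] g0[OF s(1)] by auto
  moreover have "complex_of_real (t - s) - \<i> * of_real 0 = of_real (t - s)" by simp
  ultimately show ?thesis
    by (simp only: dirichlet_integrand_def skernel_of_real[OF s(2)])
qed

lemma
  assumes t: "t \<in> {0<..<T}"
  shows dirichlet_integrand_integrable: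
      "dirichlet_integrand T l1 l2 f0 g0 lj t absolutely_integrable_on {0..t}"
    and data_limit: "((\<lambda>\<epsilon>. (1 - \<i>) * of_real (sqrt (2 * pi)) / 2 * data_term lj t \<epsilon>) \<longlongrightarrow>
      N_data T L l1 l2 q0 f0 g0 lj t) (at_right 0)"
proof -
  have sub: "{0..t} \<subseteq> {0..T}" and t0: "0 < t" using t by auto
  note cs = continuous_on_subset[OF f0'_cont sub] continuous_on_subset[OF g0'_cont sub]
    continuous_on_subset[OF l_cont(1) sub] continuous_on_subset[OF l_cont(2) sub]
  note lim1 = single_layer_limit[OF t0 cs(3,1), of "lj t"]
  note lim2 = single_layer_limit[OF t0 cs(4,2), of "lj t"]
  note int = lim1(1) lim2(1)
  show "dirichlet_integrand T l1 l2 f0 g0 lj t absolutely_integrable_on {0..t}"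
    using t by (intro absolutely_integrable_spike[OF set_integral_diff(1)[OF int], of "{}"])
      (auto simp: dirichlet_integrand_eq)
  have D: "integral {0..t} (dirichlet_integrand T l1 l2 f0 g0 lj t)
    = integral {0..t} (\<lambda>s. skernel (of_real (t - s) - \<i> * of_real 0) (of_real (lj t - l1 s)) * f0' s)
      - integral {0..t} (\<lambda>s. skernel (of_real (t - s) - \<i> * of_real 0) (of_real (lj t - l2 s)) * g0' s)"
    (is "_ = ?I1 - ?I2")
    using int t by (subst Henstock_Kurzweil_Integration.integral_diff[symmetric])
      (auto simp: absolutely_integrable_on_def dirichlet_integrand_eq intro!: integral_cong)
  have Q: "integral {0..L} (\<lambda>x. q0' x * skernel (of_real t) (of_real (x - lj t)))
    = 1 / of_real (sqrt t) * integral {0..L} (\<lambda>x. exp (\<i> * of_real ((x - lj t)\<^sup>2 / (4 * t)))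
        * vector_derivative q0 (at x within {0..L}))" (is "?Q = _")
  \<comment> \<open>Derivatives within \<open>{0..L}\<close> are unique only on a nondegenerate
    interval; for \<open>L = 0\<close> both integrals vanish.\<close>
  proof (cases "L > 0")
    case True
    have "vector_derivative q0 (at x within {0..L}) = q0' x" if "x \<in> {0..L}" for x
      using vector_derivative_within_closed_interval[OF True that] q0[OF that] by auto
    moreover have "0 \<le> t" using t by simp
    ultimately show ?thesis
      unfolding integral_mult_right[symmetric] skernel_of_real[OF \<open>0 \<le> t\<close>] by (intro integral_cong) simp
  next
    case False
    then have "L = 0" using l_le l1_0 l2_0 by simp
    then show ?thesis by simp
  qed
  have "(data_term lj t \<longlongrightarrow> ?Q - ?I1 + ?I2) (at_right 0)"
    unfolding data_term_def[abs_def]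
    by (intro tendsto_add tendsto_diff initial_layer_limit[OF t0 q0'_cont] lim1(2) lim2(2))
  then show "((\<lambda>\<epsilon>. (1 - \<i>) * of_real (sqrt (2 * pi)) / 2 * data_term lj t \<epsilon>) \<longlongrightarrow>
      N_data T L l1 l2 q0 f0 g0 lj t) (at_right 0)"
    unfolding N_data_def Q[symmetric] D diff_diff_eq2[symmetric]
    by (intro tendsto_mult_left) (simp add: algebra_simps)
qed

text \<open>\<open>regularised_identity\<close> is solved for its off-diagonal integral; every other
  term has a known limit. Existence of the off-diagonal limit is thus a conclusion.\<close>

lemma neumann_equations:
  assumes t: "t \<in> {0<..<T}"
  shows "((\<lambda>\<epsilon>. integral {0..t} (\<lambda>s. K_off l1 l2 t s \<epsilon> * g1 s)) \<longlongrightarrow>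
      N_data T L l1 l2 q0 f0 g0 l1 t + integral {0..t} (\<lambda>s. K_diag l1 t s * f1 s) - of_real pi * f1 t) (at_right 0)"
    and "((\<lambda>\<epsilon>. integral {0..t} (\<lambda>s. K_off l2 l1 t s \<epsilon> * f1 s)) \<longlongrightarrow>
      of_real pi * g1 t - N_data T L l1 l2 q0 f0 g0 l2 t + integral {0..t} (\<lambda>s. K_diag l2 t s * g1 s)) (at_right 0)"
proof -
  have t': "t \<in> {0<..T}" using t by auto
  let ?c = "(1 - \<i>) * of_real (sqrt (2 * pi)) / 2"
  have pi: "?c * (of_real (sqrt pi) / csqrt (- \<i>) * u) = of_real pi * u" for u
    using half_delta_constant by (metis mult.assoc)
  have slice: "((\<lambda>\<epsilon>. ?c * slice l1 t \<epsilon>) \<longlongrightarrow> of_real pi * f1 t) (at_right 0)"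
    "((\<lambda>\<epsilon>. ?c * slice l2 t \<epsilon>) \<longlongrightarrow> of_real pi * g1 t) (at_right 0)"
    unfolding pi[symmetric] by (intro tendsto_mult_left slice_limit_l1 slice_limit_l2 t)+
  note diag = K_diag_limit(2)[OF t' l1_deriv l1'_cont f1_cont] K_diag_limit(2)[OF t' l2_deriv l2'_cont g1_cont]
  have pos: "\<forall>\<^sub>F \<epsilon> in at_right 0. 0 < (\<epsilon>::real)" by (rule eventually_at_rightI[of 0 1]) auto
  have "((\<lambda>\<epsilon>. ?c * data_term l1 t \<epsilon> + integral {0..t} (\<lambda>s. K_off l1 l1 t s \<epsilon> * f1 s) - ?c * slice l1 t \<epsilon>) \<longlongrightarrow>
      N_data T L l1 l2 q0 f0 g0 l1 t + integral {0..t} (\<lambda>s. K_diag l1 t s * f1 s) - of_real pi * f1 t) (at_right 0)"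
    by (intro tendsto_add tendsto_diff data_limit slice diag t)
  then show "((\<lambda>\<epsilon>. integral {0..t} (\<lambda>s. K_off l1 l2 t s \<epsilon> * g1 s)) \<longlongrightarrow>
      N_data T L l1 l2 q0 f0 g0 l1 t + integral {0..t} (\<lambda>s. K_diag l1 t s * f1 s) - of_real pi * f1 t) (at_right 0)"
  proof (rule Lim_transform_eventually)
    show "\<forall>\<^sub>F \<epsilon> in at_right 0. ?c * data_term l1 t \<epsilon> + integral {0..t} (\<lambda>s. K_off l1 l1 t s \<epsilon> * f1 s)
        - ?c * slice l1 t \<epsilon> = integral {0..t} (\<lambda>s. K_off l1 l2 t s \<epsilon> * g1 s)"
      using pos by eventually_elim (unfold regularised_identity[OF t], simp)
  qed
  have "((\<lambda>\<epsilon>. ?c * slice l2 t \<epsilon> - ?c * data_term l2 t \<epsilon> + integral {0..t} (\<lambda>s. K_off l2 l2 t s \<epsilon> * g1 s)) \<longlongrightarrow>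
      of_real pi * g1 t - N_data T L l1 l2 q0 f0 g0 l2 t + integral {0..t} (\<lambda>s. K_diag l2 t s * g1 s)) (at_right 0)"
    by (intro tendsto_add tendsto_diff data_limit slice diag t)
  then show "((\<lambda>\<epsilon>. integral {0..t} (\<lambda>s. K_off l2 l1 t s \<epsilon> * f1 s)) \<longlongrightarrow>
      of_real pi * g1 t - N_data T L l1 l2 q0 f0 g0 l2 t + integral {0..t} (\<lambda>s. K_diag l2 t s * g1 s)) (at_right 0)"
  proof (rule Lim_transform_eventually)
    show "\<forall>\<^sub>F \<epsilon> in at_right 0. ?c * slice l2 t \<epsilon> - ?c * data_term l2 t \<epsilon>
        + integral {0..t} (\<lambda>s. K_off l2 l2 t s \<epsilon> * g1 s) = integral {0..t} (\<lambda>s. K_off l2 l1 t s \<epsilon> * f1 s)"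
      using pos by eventually_elim (unfold regularised_identity[OF t], simp)
  qed
qed

end

section \<open>From the solution predicate to the system of integral equations\<close>

lemma schrodinger_solutionE:
  assumes "schrodinger_solution T l1 l2 q qx"
  obtains qt qxx where
    "\<And>x t. (x, t) \<in> open_dom T l1 l2 \<Longrightarrow> ((\<lambda>s. q x s) has_vector_derivative qt x t) (at t)"
    "\<And>x t. (x, t) \<in> open_dom T l1 l2 \<Longrightarrow> ((\<lambda>y. qx y t) has_vector_derivative qxx x t) (at x)"
    "\<And>x t. (x, t) \<in> open_dom T l1 l2 \<Longrightarrow> \<i> * qt x t + qxx x t = 0"
    "continuous_on (open_dom T l1 l2) (\<lambda>(x, t). qt x t)"
    "continuous_on (open_dom T l1 l2) (\<lambda>(x, t). qxx x t)"
    "\<And>x t. (x, t) \<in> lateral_dom T l1 l2 \<Longrightarrow>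
        ((\<lambda>y. q y t) has_vector_derivative qx x t) (at x within {l1 t..l2 t})"
    "continuous_on (lateral_dom T l1 l2) (\<lambda>(x, t). qx x t)"
    "continuous_on (initial_dom T l1 l2) (\<lambda>(x, t). q x t)"
proof -
  note sol = assms[unfolded schrodinger_solution_def]
  from sol[THEN conjunct1] obtain qt qxx where
    q: "\<forall>(x, t) \<in> open_dom T l1 l2. ((\<lambda>s. q x s) has_vector_derivative qt x t) (at t) \<and>
       ((\<lambda>y. qx y t) has_vector_derivative qxx x t) (at x) \<and> \<i> * qt x t + qxx x t = 0"
    and c: "continuous_on (open_dom T l1 l2) (\<lambda>(x, t). qt x t)"
    "continuous_on (open_dom T l1 l2) (\<lambda>(x, t). qxx x t)"
    by (elim exE conjE)
  show thesis
  proof (rule that[of qt qxx])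
    fix x t assume "(x, t) \<in> open_dom T l1 l2"
    from bspec[OF q this, unfolded prod.case]
    show "((\<lambda>s. q x s) has_vector_derivative qt x t) (at t)"
      "((\<lambda>y. qx y t) has_vector_derivative qxx x t) (at x)" "\<i> * qt x t + qxx x t = 0"
      by blast+
  next
    fix x t assume "(x, t) \<in> lateral_dom T l1 l2"
    from bspec[OF sol[THEN conjunct2, THEN conjunct1] this, unfolded prod.case]
    show "((\<lambda>y. q y t) has_vector_derivative qx x t) (at x within {l1 t..l2 t})" .
  qed (rule c sol[THEN conjunct2, THEN conjunct2, THEN conjunct1] sol[THEN conjunct2, THEN conjunct2, THEN conjunct2])+
qed

theorem proposition2:
  fixes T L :: real
    and l1 l2 :: "real \<Rightarrow> real"
    and q0 f0 g0 f1 g1 :: "real \<Rightarrow> complex"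
    and q qx :: "real \<Rightarrow> real \<Rightarrow> complex"
  assumes "T > 0" and "L \<ge> 0"
    and "C1_on {0..T} l1" and "C1_on {0..T} l2"
    and "l1 0 = 0" and "l2 0 = L"
    and "\<forall>s\<in>{0<..T}. l1 s < l2 s"
    and "C1_on {0..L} q0" and "C1_on {0..T} f0" and "C1_on {0..T} g0"
    and "schrodinger_solution T l1 l2 q qx"
    and "\<forall>x\<in>{0<..<L}. q x 0 = q0 x"
    and "\<forall>t\<in>{0<..<T}. q (l1 t) t = f0 t"
    and "\<forall>t\<in>{0<..<T}. q (l2 t) t = g0 t"
    and "continuous_on {0..T} f1" and "continuous_on {0..T} g1"
    and "\<forall>t\<in>{0<..<T}. f1 t = qx (l1 t) t"
    and "\<forall>t\<in>{0<..<T}. g1 t = qx (l2 t) t"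
  shows "\<forall>t\<in>{0<..<T}.
      dirichlet_integrand T l1 l2 f0 g0 l1 t absolutely_integrable_on {0..t} \<and>
      dirichlet_integrand T l1 l2 f0 g0 l2 t absolutely_integrable_on {0..t} \<and>
      (\<lambda>s. K_diag l1 t s * f1 s) absolutely_integrable_on {0..t} \<and>
      (\<lambda>s. K_diag l2 t s * g1 s) absolutely_integrable_on {0..t} \<and>
      (\<exists>A. ((\<lambda>\<epsilon>. integral {0..t} (\<lambda>s. K_off l1 l2 t s \<epsilon> * g1 s)) \<longlongrightarrow> A) (at_right 0) \<and>
           of_real pi * f1 t =
             N_data T L l1 l2 q0 f0 g0 l1 t + integral {0..t} (\<lambda>s. K_diag l1 t s * f1 s) - A) \<and>
      (\<exists>B. ((\<lambda>\<epsilon>. integral {0..t} (\<lambda>s. K_off l2 l1 t s \<epsilon> * f1 s)) \<longlongrightarrow> B) (at_right 0) \<and>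
           of_real pi * g1 t =
             N_data T L l1 l2 q0 f0 g0 l2 t + B - integral {0..t} (\<lambda>s. K_diag l2 t s * g1 s))"
proof -
  obtain l1' l2' where l: "\<forall>s\<in>{0..T}. (l1 has_vector_derivative l1' s) (at s within {0..T})" "continuous_on {0..T} l1'"
    "\<forall>s\<in>{0..T}. (l2 has_vector_derivative l2' s) (at s within {0..T})" "continuous_on {0..T} l2'"
    using assms(3,4) unfolding C1_on_def by blast
  obtain q0' where q0: "\<forall>x\<in>{0..L}. (q0 has_vector_derivative q0' x) (at x within {0..L})" "continuous_on {0..L} q0'"
    using assms(8) unfolding C1_on_def by blast
  obtain f0' g0' where fg: "\<forall>s\<in>{0..T}. (f0 has_vector_derivative f0' s) (at s within {0..T})" "continuous_on {0..T} f0'"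
    "\<forall>s\<in>{0..T}. (g0 has_vector_derivative g0' s) (at s within {0..T})" "continuous_on {0..T} g0'"
    using assms(9,10) unfolding C1_on_def by blast
  have le: "l1 0 \<le> l2 0" using assms(2,5,6) by simp
  show ?thesis
  proof (rule schrodinger_solutionE[OF assms(11)], goal_cases)
    case q: (1 qt qxx)
    note facts = assms(1) l(1)[rule_format] l(3)[rule_format] l(2,4) le assms(7)[rule_format]
      q
      assms(5,6) q0(1)[rule_format] q0(2) assms(12)[rule_format]
      fg(1)[rule_format] fg(2) assms(15) fg(3)[rule_format] fg(4) assms(16)
      assms(13)[rule_format] assms(17)[rule_format, symmetric] assms(14)[rule_format] assms(18)[rule_format, symmetric]
    have D: "dirichlet_problem T l1 l2 l1' l2' q qx qt qxx L q0 q0' f0 f0' f1 g0 g0' g1"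
      by (rule dirichlet_problem.intro, rule moving_domain.intro, (rule facts; assumption)+,
          rule dirichlet_problem_axioms.intro, (rule facts; assumption)+)
    show ?case
    proof (intro ballI conjI)
      fix t assume t: "t \<in> {0<..<T}"
      then have t': "t \<in> {0<..T}" by auto
      show "dirichlet_integrand T l1 l2 f0 g0 l1 t absolutely_integrable_on {0..t}"
        "dirichlet_integrand T l1 l2 f0 g0 l2 t absolutely_integrable_on {0..t}"
        by (rule dirichlet_problem.dirichlet_integrand_integrable[OF D t])+
      show "(\<lambda>s. K_diag l1 t s * f1 s) absolutely_integrable_on {0..t}"
        by (rule K_diag_limit(1)[OF t' l(1)[rule_format] l(2) assms(15)])
      show "(\<lambda>s. K_diag l2 t s * g1 s) absolutely_integrable_on {0..t}"
        by (rule K_diag_limit(1)[OF t' l(3)[rule_format] l(4) assms(16)])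
      show "\<exists>A. ((\<lambda>\<epsilon>. integral {0..t} (\<lambda>s. K_off l1 l2 t s \<epsilon> * g1 s)) \<longlongrightarrow> A) (at_right 0) \<and>
          of_real pi * f1 t = N_data T L l1 l2 q0 f0 g0 l1 t + integral {0..t} (\<lambda>s. K_diag l1 t s * f1 s) - A"
        \<comment> \<open>Unification with the limit in \<open>neumann_equations\<close> supplies
          the witness; the equation is then a rearrangement.\<close>
        by (intro exI conjI, rule dirichlet_problem.neumann_equations(1)[OF D t]) simp
      show "\<exists>B. ((\<lambda>\<epsilon>. integral {0..t} (\<lambda>s. K_off l2 l1 t s \<epsilon> * f1 s)) \<longlongrightarrow> B) (at_right 0) \<and>
          of_real pi * g1 t = N_data T L l1 l2 q0 f0 g0 l2 t + B - integral {0..t} (\<lambda>s. K_diag l2 t s * g1 s)"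
        by (intro exI conjI, rule dirichlet_problem.neumann_equations(2)[OF D t]) simp
    qed
  qed
qed

end
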